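(* In the setting described in the context, let $\rho$ be a De Simone law whose trace morphism $\mathsf{tr}\colon\mu\Sigma\to T(\mu B)$ is affine. Then $\mathsf{tr}$ is a morphic $\Sigma$-congruence, i.e. there exists a $\Sigma$-algebra structure $a\colon\Sigma T(\mu B)\to T(\mu B)$ with $\mathsf{tr}\circ\iota=a\circ\Sigma\mathsf{tr}$.
   Context: Setting: $\mathcal{C}$ is a category with finite limits and finite coproducts; $\Sigma,B$ endofunctors and $(T,\eta,\mu)$ a monad on $\mathcal{C}$; $\Sigma$ has an initial algebra $(\mu\Sigma,\iota)$ and free algebras $\Sigma^{\star}X$ (free monad $\Sigma^{\star}$); $\hat\iota\colon\Sigma^{\star}(\mu\Sigma)\to\mu\Sigma$ is the unique $\Sigma$-algebra morphism extending $\mathrm{id}$. $\mathrm{Kl}(T)$: morphisms $X\rightsquigarrow Y$ are $\mathcal{C}$-morphisms $X\to TY$, $g\cdot f=\mu\circ Tg\circ f$, $Jf=\eta\circ f$. Assumptions: (1) a natural isomorphism $j_{X,Y}\colon TX\times TY\to T(X+Y)$ (so products in $\mathrm{Kl}(T)$ are carried by $X+Y$, pairing of $f,g$ being $j\circ\langle f,g\rangle$); (2) distributive laws $\delta^{\Sigma}\colon\Sigma T\to T\Sigma$, $\delta^B\colon BT\to TB$ (compatible with $\eta,\mu$), with Kleisli extensions $\bar\Sigma f=\delta^{\Sigma}\circ\Sigma f$, $\bar Bf=\delta^B\circ Bf$; the free monad of $\bar\Sigma$ is a Kleisli extension $\overline{\Sigma^{\star}}f=\delta^{\Sigma^{\star}}\circ\Sigma^{\star}f$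 of $\Sigma^{\star}$ for a distributive law $\delta^{\Sigma^{\star}}$; (3) $B$ has an initial algebra $(\mu B,\beta)$, each hom-set of $\mathrm{Kl}(T)$ is a DCPO with least element $\bot$, composition preserves directed joins in each argument and $\bot\cdot f=\bot$, and $\bar B$ is locally monotone; then $(\mu B,J\beta^{-1})$ is a final $\bar B$-coalgebra. Let $B_0X=X+BX$, $\delta^{B_0}=[T\mathsf{inl},T\mathsf{inr}]\circ(\mathrm{id}+\delta^B)$, $\bar B_0f=\delta^{B_0}\circ B_0f$. A pre-De Simone law is a natural transformation $\rho_X\colon\Sigma(X+BX)\to TB\Sigma^{\star}X$; it is natural w.r.t. a Kleisli morphism $p\colon P\rightsquigarrow X$ if $\rho_X\cdot\bar\Sigma\bar B_0p=\bar B\overline{\Sigma^{\star}}p\cdot\rho_P$. For each $X$ let $i_X\colon T_+X\to TX$ be the equalizer of $\eta_1\circ!$ and $T!\colon TX\to T1$; $T_+$ is a monad and $i$ a monad morphism. A morphism $p\colon P\to TX$ is affine if it factors through $i_X$, equivalently $T!\circ p=\eta_1\circ!$. A De Simone law is a pre-De Simone law natural w.r.t. $i_X\colon T_+X\rightsquigarrow X$ for every $X$. Its operational model is the unique $\gamma\colon\mu\Sigma\to TB(\mu\Sigma)$ with $\gamma\cdot J\iota=\bar BJ\hat\iota\cdot\rho_{\mu\Sigma}\cdot\bar\Sigma(j\circ\langle\eta,\gamma\rangle)$, and its trace morphism is the unique $\mathsf{tr}\colon\mu\Sigma\to T(\mu B)$ that is a $\bar B$-coalgebra morphism $(\mu\Sigma,\gamma)\rightsquigarrow(\mu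 B,J\beta^{-1})$, i.e. $\mu\circ T(\delta^B\circ B\mathsf{tr})\circ\gamma=T\beta^{-1}\circ\mathsf{tr}$.
   Formalization: The isomorphism j: TX×TY → T(X+Y) is assumed natural with respect to Kleisli morphisms (T acting by f ↦ μ∘Tf, + as the coproduct functor of Kl(T)), not only with respect to morphisms of C; with naturality in C alone the claim fails. *)

theory Defs
  imports Main
begin

section \<open>Categories\<close>

record ('o, 'm) category =
  Obj :: "'o set"
  Arr :: "'m set"
  Dom :: "'m \<Rightarrow> 'o"
  Cod :: "'m \<Rightarrow> 'o"
  Id :: "'o \<Rightarrow> 'm"
  Comp :: "'m \<Rightarrow> 'm \<Rightarrow> 'm"  (infixr "\<odot>\<index>" 70)

definition hom :: "('o, 'm, 'x) category_scheme \<Rightarrow> 'o \<Rightarrow> 'o \<Rightarrow> 'm set" where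
  "hom C X Y = {f \<in> Arr C. Dom C f = X \<and> Cod C f = Y}"

locale category =
  fixes C :: "('o, 'm, 'x) category_scheme" (structure)
  assumes Dom_Obj: "f \<in> Arr C \<Longrightarrow> Dom C f \<in> Obj C"
    and Cod_Obj: "f \<in> Arr C \<Longrightarrow> Cod C f \<in> Obj C"
    and Id_hom: "X \<in> Obj C \<Longrightarrow> Id C X \<in> hom C X X"
    and Comp_hom: "\<lbrakk>f \<in> hom C X Y; g \<in> hom C Y Z\<rbrakk> \<Longrightarrow> g \<odot> f \<in> hom C X Z"
    and Comp_Id_right: "f \<in> hom C X Y \<Longrightarrow> f \<odot> Id C X = f"
    and Comp_Id_left: "f \<in> hom C X Y \<Longrightarrow> Id C Y \<odot> f = f"
    and Comp_assoc:
      "\<lbrakk>f \<in> hom C W X; g \<in> hom C X Y; h \<in> hom C Y Z\<rbrakk> \<Longrightarrow> (h \<odot> g) \<odot> f = h \<odot> (g \<odot> f)"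

definition is_functor ::
  "('a, 'b, 'x) category_scheme \<Rightarrow> ('o, 'm, 'y) category_scheme \<Rightarrow> ('a \<Rightarrow> 'o) \<Rightarrow> ('b \<Rightarrow> 'm) \<Rightarrow> bool"
  where
  "is_functor D C Fo Fa \<longleftrightarrow>
     (\<forall>X \<in> Obj D. Fo X \<in> Obj C) \<and>
     (\<forall>X Y. \<forall>f \<in> hom D X Y. Fa f \<in> hom C (Fo X) (Fo Y)) \<and>
     (\<forall>X \<in> Obj D. Fa (Id D X) = Id C (Fo X)) \<and>
     (\<forall>X Y Z. \<forall>f \<in> hom D X Y. \<forall>g \<in> hom D Y Z.
        Fa (g \<odot>\<^bsub>D\<^esub> f) = Fa g \<odot>\<^bsub>C\<^esub> Fa f)"

definition is_cone ::
  "('a, 'b, 'x) category_scheme \<Rightarrow> ('o, 'm, 'y) category_scheme \<Rightarrow> ('a \<Rightarrow> 'o) \<Rightarrow> ('b \<Rightarrow> 'm)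
    \<Rightarrow> 'o \<Rightarrow> ('a \<Rightarrow> 'm) \<Rightarrow> bool" where
  "is_cone D C Fo Fa L p \<longleftrightarrow>
     L \<in> Obj C \<and> (\<forall>i \<in> Obj D. p i \<in> hom C L (Fo i)) \<and>
     (\<forall>i k. \<forall>u \<in> hom D i k. Fa u \<odot>\<^bsub>C\<^esub> p i = p k)"

definition is_limit ::
  "('a, 'b, 'x) category_scheme \<Rightarrow> ('o, 'm, 'y) category_scheme \<Rightarrow> ('a \<Rightarrow> 'o) \<Rightarrow> ('b \<Rightarrow> 'm)
    \<Rightarrow> 'o \<Rightarrow> ('a \<Rightarrow> 'm) \<Rightarrow> bool" where
  "is_limit D C Fo Fa L p \<longleftrightarrow>
     is_cone D C Fo Fa L p \<and>
     (\<forall>L' p'. is_cone D C Fo Fa L' p' \<longrightarrow>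
        (\<exists>!h. h \<in> hom C L' L \<and> (\<forall>i \<in> Obj D. p i \<odot>\<^bsub>C\<^esub> h = p' i)))"

text \<open>Every finite category is isomorphic to one whose objects and arrows are natural numbers.\<close>

definition has_finite_limits :: "('o, 'm, 'x) category_scheme \<Rightarrow> bool" where
  "has_finite_limits C \<longleftrightarrow>
     (\<forall>(D :: (nat, nat) category) Fo Fa.
        category D \<and> finite (Obj D) \<and> finite (Arr D) \<and> is_functor D C Fo Fa \<longrightarrow>
        (\<exists>L p. is_limit D C Fo Fa L p))"

definition has_finite_coproducts :: "('o, 'm, 'x) category_scheme \<Rightarrow> bool" where
  "has_finite_coproducts C \<longleftrightarrow>
     (\<forall>(n :: nat) A. (\<forall>k<n. A k \<in> Obj C) \<longrightarrow>
        (\<exists>S \<in> Obj C. \<exists>e. (\<forall>k<n. e k \<in> hom C (A k) S) \<and>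
           (\<forall>Z \<in> Obj C. \<forall>f. (\<forall>k<n. f k \<in> hom C (A k) Z) \<longrightarrow>
              (\<exists>!h. h \<in> hom C S Z \<and> (\<forall>k<n. h \<odot>\<^bsub>C\<^esub> e k = f k)))))"

definition is_terminal :: "('o, 'm, 'x) category_scheme \<Rightarrow> 'o \<Rightarrow> bool" where
  "is_terminal C I \<longleftrightarrow> I \<in> Obj C \<and> (\<forall>X \<in> Obj C. \<exists>!h. h \<in> hom C X I)"

definition is_product ::
  "('o, 'm, 'x) category_scheme \<Rightarrow> 'o \<Rightarrow> 'o \<Rightarrow> 'o \<Rightarrow> 'm \<Rightarrow> 'm \<Rightarrow> bool" where
  "is_product C X Y P p q \<longleftrightarrow>
     P \<in> Obj C \<and> p \<in> hom C P X \<and> q \<in> hom C P Y \<and>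
     (\<forall>Z \<in> Obj C. \<forall>f \<in> hom C Z X. \<forall>g \<in> hom C Z Y.
        \<exists>!h. h \<in> hom C Z P \<and> p \<odot>\<^bsub>C\<^esub> h = f \<and> q \<odot>\<^bsub>C\<^esub> h = g)"

definition is_coproduct ::
  "('o, 'm, 'x) category_scheme \<Rightarrow> 'o \<Rightarrow> 'o \<Rightarrow> 'o \<Rightarrow> 'm \<Rightarrow> 'm \<Rightarrow> bool" where
  "is_coproduct C X Y S i k \<longleftrightarrow>
     S \<in> Obj C \<and> i \<in> hom C X S \<and> k \<in> hom C Y S \<and>
     (\<forall>Z \<in> Obj C. \<forall>f \<in> hom C X Z. \<forall>g \<in> hom C Y Z.
        \<exists>!h. h \<in> hom C S Z \<and> h \<odot>\<^bsub>C\<^esub> i = f \<and> h \<odot>\<^bsub>C\<^esub> k = g)"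

definition is_equalizer ::
  "('o, 'm, 'x) category_scheme \<Rightarrow> 'o \<Rightarrow> 'o \<Rightarrow> 'm \<Rightarrow> 'm \<Rightarrow> 'o \<Rightarrow> 'm \<Rightarrow> bool" where
  "is_equalizer C X Y f g E e \<longleftrightarrow>
     f \<in> hom C X Y \<and> g \<in> hom C X Y \<and>
     E \<in> Obj C \<and> e \<in> hom C E X \<and> f \<odot>\<^bsub>C\<^esub> e = g \<odot>\<^bsub>C\<^esub> e \<and>
     (\<forall>Z \<in> Obj C. \<forall>h \<in> hom C Z X. f \<odot>\<^bsub>C\<^esub> h = g \<odot>\<^bsub>C\<^esub> h \<longrightarrow>
        (\<exists>!k. k \<in> hom C Z E \<and> e \<odot>\<^bsub>C\<^esub> k = h))"

definition is_inverse :: "('o, 'm, 'x) category_scheme \<Rightarrow> 'm \<Rightarrow> 'm \<Rightarrow> bool" where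
  "is_inverse C f g \<longleftrightarrow>
     f \<in> Arr C \<and> g \<in> hom C (Cod C f) (Dom C f) \<and>
     g \<odot>\<^bsub>C\<^esub> f = Id C (Dom C f) \<and> f \<odot>\<^bsub>C\<^esub> g = Id C (Cod C f)"

definition inverse_arr :: "('o, 'm, 'x) category_scheme \<Rightarrow> 'm \<Rightarrow> 'm" where
  "inverse_arr C f = (THE g. is_inverse C f g)"

definition initial_algebra ::
  "('o, 'm, 'x) category_scheme \<Rightarrow> ('o \<Rightarrow> 'o) \<Rightarrow> ('m \<Rightarrow> 'm) \<Rightarrow> 'o \<Rightarrow> 'm \<Rightarrow> bool" where
  "initial_algebra C Fo Fa I i \<longleftrightarrow>
     I \<in> Obj C \<and> i \<in> hom C (Fo I) I \<and>
     (\<forall>A \<in> Obj C. \<forall>a \<in> hom C (Fo A) A.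
        \<exists>!h. h \<in> hom C I A \<and> h \<odot>\<^bsub>C\<^esub> i = a \<odot>\<^bsub>C\<^esub> Fa h)"

definition free_algebra ::
  "('o, 'm, 'x) category_scheme \<Rightarrow> ('o \<Rightarrow> 'o) \<Rightarrow> ('m \<Rightarrow> 'm) \<Rightarrow> 'o \<Rightarrow> 'o \<Rightarrow> 'm \<Rightarrow> 'm \<Rightarrow> bool" where
  "free_algebra C Fo Fa X S s e \<longleftrightarrow>
     S \<in> Obj C \<and> s \<in> hom C (Fo S) S \<and> e \<in> hom C X S \<and>
     (\<forall>A \<in> Obj C. \<forall>a \<in> hom C (Fo A) A. \<forall>f \<in> hom C X A.
        \<exists>!h. h \<in> hom C S A \<and> h \<odot>\<^bsub>C\<^esub> s = a \<odot>\<^bsub>C\<^esub> Fa h \<and> h \<odot>\<^bsub>C\<^esub> e = f)"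


section \<open>Directed-complete partial orders on carrier sets\<close>

definition is_lub_on :: "'m set \<Rightarrow> ('m \<Rightarrow> 'm \<Rightarrow> bool) \<Rightarrow> 'm set \<Rightarrow> 'm \<Rightarrow> bool" where
  "is_lub_on A le D s \<longleftrightarrow>
     s \<in> A \<and> (\<forall>x \<in> D. le x s) \<and> (\<forall>u \<in> A. (\<forall>x \<in> D. le x u) \<longrightarrow> le s u)"

definition is_least_on :: "'m set \<Rightarrow> ('m \<Rightarrow> 'm \<Rightarrow> bool) \<Rightarrow> 'm \<Rightarrow> bool" where
  "is_least_on A le b \<longleftrightarrow> b \<in> A \<and> (\<forall>x \<in> A. le b x)"

definition directed_in :: "'m set \<Rightarrow> ('m \<Rightarrow> 'm \<Rightarrow> bool) \<Rightarrow> 'm set \<Rightarrow> bool" where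
  "directed_in A le D \<longleftrightarrow>
     D \<noteq> {} \<and> D \<subseteq> A \<and> (\<forall>x \<in> D. \<forall>y \<in> D. \<exists>z \<in> D. le x z \<and> le y z)"

definition pointed_dcpo_on :: "'m set \<Rightarrow> ('m \<Rightarrow> 'm \<Rightarrow> bool) \<Rightarrow> bool" where
  "pointed_dcpo_on A le \<longleftrightarrow>
     reflp_on A le \<and> transp_on A le \<and> antisymp_on A le \<and>
     (\<forall>D. directed_in A le D \<longrightarrow> (\<exists>s. is_lub_on A le D s)) \<and>
     (\<exists>b. is_least_on A le b)"


section \<open>The data of the setting\<close>

text \<open>
  Suffixes \<open>O\<close> and \<open>A\<close> mark the object and arrow part of a functor. The free monad is given by
  the free algebras \<open>SigO (StarO X) \<rightarrow> StarO X \<leftarrow> X\<close> with structure \<open>star_op X\<close> and unit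
  \<open>star_unit X\<close>; its action on arrows is derived below.
  \<open>kle X Y\<close> is the order on the Kleisli hom-set from \<open>X\<close> to \<open>Y\<close>.
  \<open>aff X : TplusO X \<rightarrow> TO X\<close> is the inclusion of the affine part of the monad.
\<close>

record ('o, 'm) setting = "('o, 'm) category" +
  One :: 'o
  Prd :: "'o \<Rightarrow> 'o \<Rightarrow> 'o"
  pr1 :: "'o \<Rightarrow> 'o \<Rightarrow> 'm"
  pr2 :: "'o \<Rightarrow> 'o \<Rightarrow> 'm"
  Cop :: "'o \<Rightarrow> 'o \<Rightarrow> 'o"
  inl :: "'o \<Rightarrow> 'o \<Rightarrow> 'm"
  inr :: "'o \<Rightarrow> 'o \<Rightarrow> 'm"
  SigO :: "'o \<Rightarrow> 'o"
  SigA :: "'m \<Rightarrow> 'm"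
  BO :: "'o \<Rightarrow> 'o"
  BA :: "'m \<Rightarrow> 'm"
  TO :: "'o \<Rightarrow> 'o"
  TA :: "'m \<Rightarrow> 'm"
  eta :: "'o \<Rightarrow> 'm"
  mu :: "'o \<Rightarrow> 'm"
  muSig :: 'o
  iota :: 'm
  StarO :: "'o \<Rightarrow> 'o"
  star_op :: "'o \<Rightarrow> 'm"
  star_unit :: "'o \<Rightarrow> 'm"
  jay :: "'o \<Rightarrow> 'o \<Rightarrow> 'm"
  dSig :: "'o \<Rightarrow> 'm"
  dB :: "'o \<Rightarrow> 'm"
  dStar :: "'o \<Rightarrow> 'm"
  muB :: 'o
  beta :: 'm
  kle :: "'o \<Rightarrow> 'o \<Rightarrow> 'm \<Rightarrow> 'm \<Rightarrow> bool"
  TplusO :: "'o \<Rightarrow> 'o"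
  aff :: "'o \<Rightarrow> 'm"

definition bang :: "('o, 'm) setting \<Rightarrow> 'o \<Rightarrow> 'm" where
  "bang M X = (THE h. h \<in> hom M X (One M))"

definition pair :: "('o, 'm) setting \<Rightarrow> 'm \<Rightarrow> 'm \<Rightarrow> 'm" where
  "pair M f g = (THE h. h \<in> hom M (Dom M f) (Prd M (Cod M f) (Cod M g)) \<and>
     pr1 M (Cod M f) (Cod M g) \<odot>\<^bsub>M\<^esub> h = f \<and> pr2 M (Cod M f) (Cod M g) \<odot>\<^bsub>M\<^esub> h = g)"

definition copair :: "('o, 'm) setting \<Rightarrow> 'm \<Rightarrow> 'm \<Rightarrow> 'm" where
  "copair M f g = (THE h. h \<in> hom M (Cop M (Dom M f) (Dom M g)) (Cod M f) \<and>
     h \<odot>\<^bsub>M\<^esub> inl M (Dom M f) (Dom M g) = f \<and> h \<odot>\<^bsub>M\<^esub> inr M (Dom M f) (Dom M g) = g)"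

definition prod_arr :: "('o, 'm) setting \<Rightarrow> 'm \<Rightarrow> 'm \<Rightarrow> 'm" where
  "prod_arr M f g = pair M (f \<odot>\<^bsub>M\<^esub> pr1 M (Dom M f) (Dom M g)) (g \<odot>\<^bsub>M\<^esub> pr2 M (Dom M f) (Dom M g))"

definition cop_arr :: "('o, 'm) setting \<Rightarrow> 'm \<Rightarrow> 'm \<Rightarrow> 'm" where
  "cop_arr M f g = copair M (inl M (Cod M f) (Cod M g) \<odot>\<^bsub>M\<^esub> f) (inr M (Cod M f) (Cod M g) \<odot>\<^bsub>M\<^esub> g)"

text \<open>
  \<open>star_ext M X a f : StarO X \<rightarrow> A\<close> is the algebra morphism extending \<open>f : X \<rightarrow> A\<close>, for an
  algebra \<open>a : SigO A \<rightarrow> A\<close>.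
\<close>

definition star_ext :: "('o, 'm) setting \<Rightarrow> 'o \<Rightarrow> 'm \<Rightarrow> 'm \<Rightarrow> 'm" where
  "star_ext M X a f = (THE h. h \<in> hom M (StarO M X) (Cod M a) \<and>
     h \<odot>\<^bsub>M\<^esub> star_op M X = a \<odot>\<^bsub>M\<^esub> SigA M h \<and> h \<odot>\<^bsub>M\<^esub> star_unit M X = f)"

definition StarA :: "('o, 'm) setting \<Rightarrow> 'm \<Rightarrow> 'm" where
  "StarA M f =
     star_ext M (Dom M f) (star_op M (Cod M f)) (star_unit M (Cod M f) \<odot>\<^bsub>M\<^esub> f)"

definition iota_hat :: "('o, 'm) setting \<Rightarrow> 'm" where
  "iota_hat M = star_ext M (muSig M) (iota M) (Id M (muSig M))"


subsection \<open>The Kleisli category\<close>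

text \<open>
  An arrow may be of the form \<open>X \<rightarrow> TO Y\<close> for several \<open>Y\<close>, so operations on Kleisli morphisms
  carry their Kleisli codomain as an argument: in \<open>kcomp M Z g f\<close> it is that of \<open>g\<close>, in
  \<open>SigBar M X p\<close> etc. that of \<open>p\<close>.
\<close>

definition khom :: "('o, 'm) setting \<Rightarrow> 'o \<Rightarrow> 'o \<Rightarrow> 'm set" where
  "khom M X Y = (if Y \<in> Obj M then hom M X (TO M Y) else {})"

definition kcomp :: "('o, 'm) setting \<Rightarrow> 'o \<Rightarrow> 'm \<Rightarrow> 'm \<Rightarrow> 'm" where
  "kcomp M Z g f = mu M Z \<odot>\<^bsub>M\<^esub> TA M g \<odot>\<^bsub>M\<^esub> f"

definition J :: "('o, 'm) setting \<Rightarrow> 'm \<Rightarrow> 'm" where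
  "J M f = eta M (Cod M f) \<odot>\<^bsub>M\<^esub> f"

definition SigBar :: "('o, 'm) setting \<Rightarrow> 'o \<Rightarrow> 'm \<Rightarrow> 'm" where
  "SigBar M X p = dSig M X \<odot>\<^bsub>M\<^esub> SigA M p"

definition BBar :: "('o, 'm) setting \<Rightarrow> 'o \<Rightarrow> 'm \<Rightarrow> 'm" where
  "BBar M X p = dB M X \<odot>\<^bsub>M\<^esub> BA M p"

definition StarBar :: "('o, 'm) setting \<Rightarrow> 'o \<Rightarrow> 'm \<Rightarrow> 'm" where
  "StarBar M X p = dStar M X \<odot>\<^bsub>M\<^esub> StarA M p"

definition B0O :: "('o, 'm) setting \<Rightarrow> 'o \<Rightarrow> 'o" where
  "B0O M X = Cop M X (BO M X)"

definition B0A :: "('o, 'm) setting \<Rightarrow> 'm \<Rightarrow> 'm" where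
  "B0A M f = cop_arr M f (BA M f)"

definition dB0 :: "('o, 'm) setting \<Rightarrow> 'o \<Rightarrow> 'm" where
  "dB0 M X = copair M (TA M (inl M X (BO M X))) (TA M (inr M X (BO M X)))
     \<odot>\<^bsub>M\<^esub> cop_arr M (Id M (TO M X)) (dB M X)"

definition B0Bar :: "('o, 'm) setting \<Rightarrow> 'o \<Rightarrow> 'm \<Rightarrow> 'm" where
  "B0Bar M X p = dB0 M X \<odot>\<^bsub>M\<^esub> B0A M p"

text \<open>
  Kleisli pairing of \<open>f : Z \<rightarrow> TO X\<close> and \<open>g : Z \<rightarrow> TO Y\<close>, and the action on Kleisli morphisms
  \<open>f : X \<rightarrow> TO X'\<close>, \<open>g : Y \<rightarrow> TO Y'\<close> of the coproduct functor, coproducts in the Kleisli category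
  being those of the base category.
\<close>

definition kpair :: "('o, 'm) setting \<Rightarrow> 'o \<Rightarrow> 'o \<Rightarrow> 'm \<Rightarrow> 'm \<Rightarrow> 'm" where
  "kpair M X Y f g = jay M X Y \<odot>\<^bsub>M\<^esub> pair M f g"

definition kcop_arr :: "('o, 'm) setting \<Rightarrow> 'o \<Rightarrow> 'o \<Rightarrow> 'm \<Rightarrow> 'm \<Rightarrow> 'm" where
  "kcop_arr M X' Y' f g = copair M (TA M (inl M X' Y') \<odot>\<^bsub>M\<^esub> f) (TA M (inr M X' Y') \<odot>\<^bsub>M\<^esub> g)"

definition monad :: "('o, 'm) setting \<Rightarrow> bool" where
  "monad M \<longleftrightarrow>
     is_functor M M (TO M) (TA M) \<and>
     (\<forall>X \<in> Obj M. eta M X \<in> hom M X (TO M X) \<and> mu M X \<in> hom M (TO M (TO M X)) (TO M X)) \<and>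
     (\<forall>X Y. \<forall>f \<in> hom M X Y.
        TA M f \<odot>\<^bsub>M\<^esub> eta M X = eta M Y \<odot>\<^bsub>M\<^esub> f \<and>
        TA M f \<odot>\<^bsub>M\<^esub> mu M X = mu M Y \<odot>\<^bsub>M\<^esub> TA M (TA M f)) \<and>
     (\<forall>X \<in> Obj M.
        mu M X \<odot>\<^bsub>M\<^esub> eta M (TO M X) = Id M (TO M X) \<and>
        mu M X \<odot>\<^bsub>M\<^esub> TA M (eta M X) = Id M (TO M X) \<and>
        mu M X \<odot>\<^bsub>M\<^esub> TA M (mu M X) = mu M X \<odot>\<^bsub>M\<^esub> mu M (TO M X))"

definition distributive_law ::
  "('o, 'm) setting \<Rightarrow> ('o \<Rightarrow> 'o) \<Rightarrow> ('m \<Rightarrow> 'm) \<Rightarrow> ('o \<Rightarrow> 'm) \<Rightarrow> bool" where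
  "distributive_law M Fo Fa d \<longleftrightarrow>
     (\<forall>X \<in> Obj M. d X \<in> hom M (Fo (TO M X)) (TO M (Fo X))) \<and>
     (\<forall>X Y. \<forall>f \<in> hom M X Y. d Y \<odot>\<^bsub>M\<^esub> Fa (TA M f) = TA M (Fa f) \<odot>\<^bsub>M\<^esub> d X) \<and>
     (\<forall>X \<in> Obj M.
        d X \<odot>\<^bsub>M\<^esub> Fa (eta M X) = eta M (Fo X) \<and>
        d X \<odot>\<^bsub>M\<^esub> Fa (mu M X) = mu M (Fo X) \<odot>\<^bsub>M\<^esub> TA M (d X) \<odot>\<^bsub>M\<^esub> d (TO M X))"

text \<open>
  The product in the Kleisli category is carried by the coproduct of the base category, with
  pairing \<open>kpair\<close>.
\<close>

definition kleisli_product :: "('o, 'm) setting \<Rightarrow> 'o \<Rightarrow> 'o \<Rightarrow> bool" where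
  "kleisli_product M X Y \<longleftrightarrow>
     (\<exists>p \<in> khom M (Cop M X Y) X. \<exists>q \<in> khom M (Cop M X Y) Y.
        \<forall>Z \<in> Obj M. \<forall>f \<in> khom M Z X. \<forall>g \<in> khom M Z Y. \<forall>h \<in> khom M Z (Cop M X Y).
          (kcomp M X p h = f \<and> kcomp M Y q h = g) \<longleftrightarrow> h = kpair M X Y f g)"

text \<open>
  The free monad on \<open>SigBar\<close> in the Kleisli category is the Kleisli extension \<open>StarBar\<close>: free
  algebras are \<open>J\<close>-images of free \<open>SigA\<close>-algebras, and \<open>StarBar\<close> is the induced functor action.
\<close>

definition kleisli_free_monad :: "('o, 'm) setting \<Rightarrow> bool" where
  "kleisli_free_monad M \<longleftrightarrow>
     (\<forall>X \<in> Obj M. \<forall>A \<in> Obj M. \<forall>a \<in> khom M (SigO M A) A. \<forall>f \<in> khom M X A.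
        \<exists>!h. h \<in> khom M (StarO M X) A \<and>
          kcomp M A h (J M (star_op M X)) = kcomp M A a (SigBar M A h) \<and>
          kcomp M A h (J M (star_unit M X)) = f) \<and>
     (\<forall>X \<in> Obj M. \<forall>Y \<in> Obj M. \<forall>f \<in> khom M X Y.
        kcomp M (StarO M Y) (StarBar M Y f) (J M (star_op M X)) =
          kcomp M (StarO M Y) (J M (star_op M Y)) (SigBar M (StarO M Y) (StarBar M Y f)) \<and>
        kcomp M (StarO M Y) (StarBar M Y f) (J M (star_unit M X)) =
          kcomp M (StarO M Y) (J M (star_unit M Y)) f)"


section \<open>The standing assumptions\<close>

text \<open>
  Naturality of \<open>jay\<close> is naturality in the Kleisli category, that is, of a transformation
  \<open>T X \<times> T Y \<rightarrow> T (X + Y)\<close> between functors on pairs of Kleisli morphisms, where \<open>T\<close> is the right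
  adjoint of \<open>J\<close>, acting by \<open>f \<mapsto> mu \<circ> T f\<close>. Taking \<open>f\<close> and \<open>g\<close> in the image of \<open>J\<close> yields naturality
  in the base category.
\<close>

locale de_simone_setting = category M
  for M :: "('o, 'm) setting" (structure) +
  assumes finite_limits: "has_finite_limits M"
    and finite_coproducts: "has_finite_coproducts M"
    and One: "is_terminal M (One M)"
    and Prd: "\<lbrakk>X \<in> Obj M; Y \<in> Obj M\<rbrakk> \<Longrightarrow> is_product M X Y (Prd M X Y) (pr1 M X Y) (pr2 M X Y)"
    and Cop: "\<lbrakk>X \<in> Obj M; Y \<in> Obj M\<rbrakk> \<Longrightarrow> is_coproduct M X Y (Cop M X Y) (inl M X Y) (inr M X Y)"
    and Sig: "is_functor M M (SigO M) (SigA M)"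
    and B: "is_functor M M (BO M) (BA M)"
    and T: "monad M"
    and muSig: "initial_algebra M (SigO M) (SigA M) (muSig M) (iota M)"
    and Star: "X \<in> Obj M \<Longrightarrow>
      free_algebra M (SigO M) (SigA M) X (StarO M X) (star_op M X) (star_unit M X)"
    and jay_hom: "\<lbrakk>X \<in> Obj M; Y \<in> Obj M\<rbrakk> \<Longrightarrow>
      jay M X Y \<in> hom M (Prd M (TO M X) (TO M Y)) (TO M (Cop M X Y))"
    and jay_iso: "\<lbrakk>X \<in> Obj M; Y \<in> Obj M\<rbrakk> \<Longrightarrow> \<exists>k. is_inverse M (jay M X Y) k"
    and jay_natural: "\<lbrakk>X \<in> Obj M; Y \<in> Obj M; f \<in> khom M X X'; g \<in> khom M Y Y'\<rbrakk> \<Longrightarrow>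
      mu M (Cop M X' Y') \<odot> TA M (kcop_arr M X' Y' f g) \<odot> jay M X Y =
      jay M X' Y' \<odot> prod_arr M (mu M X' \<odot> TA M f) (mu M Y' \<odot> TA M g)"
    and jay_product: "\<lbrakk>X \<in> Obj M; Y \<in> Obj M\<rbrakk> \<Longrightarrow> kleisli_product M X Y"
    and dSig: "distributive_law M (SigO M) (SigA M) (dSig M)"
    and dB: "distributive_law M (BO M) (BA M) (dB M)"
    and dStar: "distributive_law M (StarO M) (StarA M) (dStar M)"
    and Star_Kleisli: "kleisli_free_monad M"
    and muB: "initial_algebra M (BO M) (BA M) (muB M) (beta M)"
    and kle_dcpo: "\<lbrakk>X \<in> Obj M; Y \<in> Obj M\<rbrakk> \<Longrightarrow> pointed_dcpo_on (khom M X Y) (kle M X Y)"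
    and kcomp_join_right: "\<lbrakk>X \<in> Obj M; Y \<in> Obj M; Z \<in> Obj M; g \<in> khom M Y Z;
        directed_in (khom M X Y) (kle M X Y) D; is_lub_on (khom M X Y) (kle M X Y) D s\<rbrakk> \<Longrightarrow>
      is_lub_on (khom M X Z) (kle M X Z) ((\<lambda>f. kcomp M Z g f) ` D) (kcomp M Z g s)"
    and kcomp_join_left: "\<lbrakk>X \<in> Obj M; Y \<in> Obj M; Z \<in> Obj M; f \<in> khom M X Y;
        directed_in (khom M Y Z) (kle M Y Z) D; is_lub_on (khom M Y Z) (kle M Y Z) D s\<rbrakk> \<Longrightarrow>
      is_lub_on (khom M X Z) (kle M X Z) ((\<lambda>g. kcomp M Z g f) ` D) (kcomp M Z s f)"
    and kcomp_bot: "\<lbrakk>X \<in> Obj M; Y \<in> Obj M; Z \<in> Obj M; f \<in> khom M X Y;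
        is_least_on (khom M Y Z) (kle M Y Z) b\<rbrakk> \<Longrightarrow>
      is_least_on (khom M X Z) (kle M X Z) (kcomp M Z b f)"
    and BBar_mono: "\<lbrakk>X \<in> Obj M; Y \<in> Obj M; f \<in> khom M X Y; g \<in> khom M X Y; kle M X Y f g\<rbrakk> \<Longrightarrow>
      kle M (BO M X) (BO M Y) (BBar M Y f) (BBar M Y g)"
    and aff: "X \<in> Obj M \<Longrightarrow>
      is_equalizer M (TO M X) (TO M (One M))
        (eta M (One M) \<odot> bang M (TO M X)) (TA M (bang M X)) (TplusO M X) (aff M X)"


section \<open>De Simone laws\<close>

definition pre_de_simone_law :: "('o, 'm) setting \<Rightarrow> ('o \<Rightarrow> 'm) \<Rightarrow> bool" where
  "pre_de_simone_law M \<rho> \<longleftrightarrow>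
     (\<forall>X \<in> Obj M. \<rho> X \<in> hom M (SigO M (B0O M X)) (TO M (BO M (StarO M X)))) \<and>
     (\<forall>X Y. \<forall>f \<in> hom M X Y.
        \<rho> Y \<odot>\<^bsub>M\<^esub> SigA M (B0A M f) = TA M (BA M (StarA M f)) \<odot>\<^bsub>M\<^esub> \<rho> X)"

definition natural_wrt :: "('o, 'm) setting \<Rightarrow> ('o \<Rightarrow> 'm) \<Rightarrow> 'o \<Rightarrow> 'o \<Rightarrow> 'm \<Rightarrow> bool" where
  "natural_wrt M \<rho> P X p \<longleftrightarrow>
     kcomp M (BO M (StarO M X)) (\<rho> X) (SigBar M (B0O M X) (B0Bar M X p)) =
     kcomp M (BO M (StarO M X)) (BBar M (StarO M X) (StarBar M X p)) (\<rho> P)"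

definition de_simone_law :: "('o, 'm) setting \<Rightarrow> ('o \<Rightarrow> 'm) \<Rightarrow> bool" where
  "de_simone_law M \<rho> \<longleftrightarrow>
     pre_de_simone_law M \<rho> \<and> (\<forall>X \<in> Obj M. natural_wrt M \<rho> (TplusO M X) X (aff M X))"

definition affine :: "('o, 'm) setting \<Rightarrow> 'o \<Rightarrow> 'o \<Rightarrow> 'm \<Rightarrow> bool" where
  "affine M P X p \<longleftrightarrow> (\<exists>q \<in> hom M P (TplusO M X). p = aff M X \<odot>\<^bsub>M\<^esub> q)"

definition operational_model :: "('o, 'm) setting \<Rightarrow> ('o \<Rightarrow> 'm) \<Rightarrow> 'm \<Rightarrow> bool" where
  "operational_model M \<rho> \<gamma> \<longleftrightarrow>
     \<gamma> \<in> khom M (muSig M) (BO M (muSig M)) \<and>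
     kcomp M (BO M (muSig M)) \<gamma> (J M (iota M)) =
       kcomp M (BO M (muSig M)) (BBar M (muSig M) (J M (iota_hat M)))
         (kcomp M (BO M (StarO M (muSig M))) (\<rho> (muSig M))
           (SigBar M (B0O M (muSig M))
             (kpair M (muSig M) (BO M (muSig M)) (eta M (muSig M)) \<gamma>)))"

definition trace_morphism :: "('o, 'm) setting \<Rightarrow> 'm \<Rightarrow> 'm \<Rightarrow> bool" where
  "trace_morphism M \<gamma> tr \<longleftrightarrow>
     tr \<in> khom M (muSig M) (muB M) \<and>
     kcomp M (BO M (muB M)) (BBar M (muB M) tr) \<gamma> =
       kcomp M (BO M (muB M)) (J M (inverse_arr M (beta M))) tr"

definition morphic_congruence :: "('o, 'm) setting \<Rightarrow> 'o \<Rightarrow> 'm \<Rightarrow> bool" where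
  "morphic_congruence M Y f \<longleftrightarrow>
     (\<exists>a \<in> hom M (SigO M Y) Y. f \<odot>\<^bsub>M\<^esub> iota M = a \<odot>\<^bsub>M\<^esub> SigA M f)"

end

theory Submission
  imports Defs
begin

text \<open>
  Work in the Kleisli category and write \<open>F\<close> for the free monad there. Every coalgebra on \<open>X\<close> extends by
  primitive recursion, using \<open>\<rho>\<close>, to one on \<open>F X\<close>; let \<open>c\<close> and \<open>d\<close> be the extensions of the final
  coalgebra \<open>Z = \<mu>B\<close> and of the operational model on \<open>I = \<mu>\<Sigma>\<close>. Distributive laws preserve affineness, so
  \<open>F tr\<close> is affine, and naturality of \<open>\<rho>\<close> at affine morphisms makes \<open>F tr : d \<rightarrow> c\<close> and the evaluation
  \<open>k : F I \<rightarrow> I\<close> coalgebra morphisms. With \<open>b : F Z \<rightarrow> Z\<close> the morphism induced by \<open>c\<close>, finality gives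
  \<open>tr \<odot> k = b \<odot> F tr\<close>; restricting to depth-one terms exhibits \<open>b\<close> restricted to \<open>\<Sigma> Z\<close> as the required algebra.
  Finality of \<open>\<mu>B\<close> itself is derived from its initiality by a fixed point argument.
\<close>

section \<open>Categories with free algebras\<close>

text \<open>The obstacle is that \<open>\<rho>\<close> is known to be natural only at affine Kleisli
  morphisms. Naturality is therefore invoked at just two of them: the evaluation \<open>k\<close>,
  affine because it is the \<open>J\<close>-image of a base morphism, and \<open>F tr\<close>, where
  affineness of \<open>tr\<close> enters. Coinduction runs on \<open>F Z\<close> and not on
  \<open>\<Sigma> Z\<close> because \<open>\<rho>\<close> answers with a whole term as successor, so
  the carrier of the coalgebra has to contain all terms. The recursion defining \<open>c\<close> and
  \<open>d\<close> is primitive and not mere iteration because \<open>\<rho>\<close> sees the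
  arguments of an operator besides their behaviours; both are handed to it by Kleisli pairing, which
  \<open>jay\<close> realises on the coproduct. As for finality, \<open>BBar\<close> is only assumed
  locally monotone, so the chain of finite iterates from \<open>\<bottom>\<close> need not reach a
  fixed point. A fixed point theorem for monotone maps on pointed dcpos replaces it, together with
  an induction principle that yields uniqueness.\<close>

context category
begin

lemma Arr_Comp [simp]:
  assumes "f \<in> Arr C" "g \<in> Arr C" "Dom C g = Cod C f"
  shows "g \<odot> f \<in> Arr C" "Dom C (g \<odot> f) = Dom C f" "Cod C (g \<odot> f) = Cod C g"
  using Comp_hom[of f "Dom C f" "Cod C f" g "Cod C g"] assms by (auto simp: hom_def)

lemma Arr_Comp_assoc [simp]:
  "\<lbrakk>f \<in> Arr C; g \<in> Arr C; h \<in> Arr C; Dom C g = Cod C f; Dom C h = Cod C g\<rbrakk>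
    \<Longrightarrow> (h \<odot> g) \<odot> f = h \<odot> (g \<odot> f)"
  by (rule Comp_assoc) (auto simp: hom_def)

lemma Comp_reassoc:
  "\<lbrakk>h \<odot> g = k; f \<in> Arr C; g \<in> Arr C; h \<in> Arr C; Dom C g = Cod C f; Dom C h = Cod C g\<rbrakk>
    \<Longrightarrow> h \<odot> (g \<odot> f) = k \<odot> f"
  by (metis Arr_Comp_assoc)

lemma Id_Arr [simp]:
  assumes "X \<in> Obj C"
  shows "Id C X \<in> Arr C" "Dom C (Id C X) = X" "Cod C (Id C X) = X"
  using Id_hom[OF assms] by (auto simp: hom_def)

lemma Comp_Id [simp]:
  "f \<in> Arr C \<Longrightarrow> Dom C f = X \<Longrightarrow> f \<odot> Id C X = f"
  "f \<in> Arr C \<Longrightarrow> Cod C f = X \<Longrightarrow> Id C X \<odot> f = f"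
  by (rule Comp_Id_right Comp_Id_left, auto simp: hom_def)+

lemmas Dom_Cod_Obj [simp] = Dom_Obj Cod_Obj

lemma hom_Obj: "f \<in> hom C X Y \<Longrightarrow> X \<in> Obj C" "f \<in> hom C X Y \<Longrightarrow> Y \<in> Obj C"
  by (auto simp: hom_def)

end

locale endofunctor = category +
  fixes Fo Fa
  assumes is_functor: "is_functor C C Fo Fa"
begin

lemma Obj_map [simp]: "X \<in> Obj C \<Longrightarrow> Fo X \<in> Obj C"
  using is_functor by (simp add: is_functor_def)

lemma Arr_map [simp]:
  assumes "f \<in> Arr C"
  shows "Fa f \<in> Arr C" "Dom C (Fa f) = Fo (Dom C f)" "Cod C (Fa f) = Fo (Cod C f)"
  using is_functor assms by (auto simp: is_functor_def hom_def)

lemma map_Id [simp]: "X \<in> Obj C \<Longrightarrow> Fa (Id C X) = Id C (Fo X)"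
  using is_functor by (simp add: is_functor_def)

lemma map_Comp:
  "\<lbrakk>f \<in> Arr C; g \<in> Arr C; Dom C g = Cod C f\<rbrakk> \<Longrightarrow> Fa (g \<odot> f) = Fa g \<odot> Fa f"
  using is_functor unfolding is_functor_def hom_def by blast

end

section \<open>Binary products and pairing\<close>

locale products = category +
  fixes Pr p1 p2
  assumes product:
    "\<lbrakk>X \<in> Obj C; Y \<in> Obj C\<rbrakk> \<Longrightarrow> is_product C X Y (Pr X Y) (p1 X Y) (p2 X Y)"
begin

definition tuple where
  "tuple f g = (THE h. h \<in> hom C (Dom C f) (Pr (Cod C f) (Cod C g)) \<and>
     p1 (Cod C f) (Cod C g) \<odot> h = f \<and> p2 (Cod C f) (Cod C g) \<odot> h = g)"

lemma Pr_Obj [simp]: "\<lbrakk>X \<in> Obj C; Y \<in> Obj C\<rbrakk> \<Longrightarrow> Pr X Y \<in> Obj C"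
  using product unfolding is_product_def by blast

lemma Arr_proj [simp]:
  assumes "X \<in> Obj C" "Y \<in> Obj C"
  shows "p1 X Y \<in> Arr C" "Dom C (p1 X Y) = Pr X Y" "Cod C (p1 X Y) = X"
    "p2 X Y \<in> Arr C" "Dom C (p2 X Y) = Pr X Y" "Cod C (p2 X Y) = Y"
  using product[OF assms] by (auto simp: is_product_def hom_def)

lemma tuple_ex1:
  assumes "f \<in> Arr C" "g \<in> Arr C" "Dom C f = Dom C g"
  shows "\<exists>!h. h \<in> hom C (Dom C f) (Pr (Cod C f) (Cod C g)) \<and>
    p1 (Cod C f) (Cod C g) \<odot> h = f \<and> p2 (Cod C f) (Cod C g) \<odot> h = g"
  using product[of "Cod C f" "Cod C g"] assms
  unfolding is_product_def hom_def by (simp (no_asm_use) add: hom_def) auto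

lemma tuple [simp]:
  assumes "f \<in> Arr C" "g \<in> Arr C" "Dom C f = Dom C g"
  shows "tuple f g \<in> Arr C" "Dom C (tuple f g) = Dom C g"
    "Cod C (tuple f g) = Pr (Cod C f) (Cod C g)"
    and p1_tuple: "\<And>X Y. \<lbrakk>Cod C f = X; Cod C g = Y\<rbrakk> \<Longrightarrow> p1 X Y \<odot> tuple f g = f"
    and p2_tuple: "\<And>X Y. \<lbrakk>Cod C f = X; Cod C g = Y\<rbrakk> \<Longrightarrow> p2 X Y \<odot> tuple f g = g"
  using theI'[OF tuple_ex1[OF assms]] assms(3)
  unfolding tuple_def[symmetric] by (auto simp: hom_def)

lemma tuple_eqI:
  assumes "h \<in> Arr C" "Cod C h = Pr X Y" "X \<in> Obj C" "Y \<in> Obj C"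
    and "p1 X Y \<odot> h = f" "p2 X Y \<odot> h = g"
  shows "h = tuple f g"
proof -
  have a: "f \<in> Arr C" "g \<in> Arr C" "Dom C f = Dom C g" "Dom C f = Dom C h"
    "Cod C f = X" "Cod C g = Y"
    using assms by auto
  let ?P = "\<lambda>h. h \<in> hom C (Dom C f) (Pr X Y) \<and> p1 X Y \<odot> h = f \<and> p2 X Y \<odot> h = g"
  have "?P h" "?P (tuple f g)" using a assms by (simp_all add: hom_def)
  moreover have "\<exists>!h. ?P h" using tuple_ex1[OF a(1-3)] unfolding a(5,6) .
  ultimately show ?thesis by blast
qed

lemma tuple_Comp:
  assumes "f \<in> Arr C" "g \<in> Arr C" "h \<in> Arr C" "Dom C f = Cod C h" "Dom C g = Cod C h"
  shows "tuple f g \<odot> h = tuple (f \<odot> h) (g \<odot> h)"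
  using assms
  by (intro tuple_eqI[where X="Cod C f" and Y="Cod C g"])
    (auto simp: Arr_Comp_assoc[symmetric] simp del: Arr_Comp_assoc)

lemma proj_tuple_assoc [simp]:
  assumes "f \<in> Arr C" "g \<in> Arr C" "Dom C f = Dom C g" "h \<in> Arr C" "Cod C h = Dom C g"
    "Cod C f = X" "Cod C g = Y"
  shows "p1 X Y \<odot> (tuple f g \<odot> h) = f \<odot> h" "p2 X Y \<odot> (tuple f g \<odot> h) = g \<odot> h"
  using assms by (auto simp: tuple_Comp)

end

section \<open>Free algebras and primitive recursion\<close>

locale free_algebras = products C Pr p1 p2 + S: endofunctor C So Sa
  for C :: "('o, 'm, 'x) category_scheme" (structure) and Pr p1 p2 So Sa +
  fixes Fo s e
  assumes free: "X \<in> Obj C \<Longrightarrow> free_algebra C So Sa X (Fo X) (s X) (e X)"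
begin

lemma free_Arr [simp]:
  assumes "X \<in> Obj C"
  shows "Fo X \<in> Obj C" "s X \<in> Arr C" "Dom C (s X) = So (Fo X)" "Cod C (s X) = Fo X"
    "e X \<in> Arr C" "Dom C (e X) = X" "Cod C (e X) = Fo X"
  using free[OF assms] by (auto simp: free_algebra_def hom_def)

lemma free_ex1:
  assumes "a \<in> hom C (So A) A" "f \<in> hom C X A"
  shows "\<exists>!h. h \<in> hom C (Fo X) A \<and> h \<odot> s X = a \<odot> Sa h \<and> h \<odot> e X = f"
  using free[of X] assms unfolding free_algebra_def by (simp add: hom_Obj[OF assms(2)])

lemma free_eq:
  assumes "a \<in> hom C (So A) A" "X \<in> Obj C" "h \<in> hom C (Fo X) A" "k \<in> hom C (Fo X) A"
    "h \<odot> s X = a \<odot> Sa h" "k \<odot> s X = a \<odot> Sa k" "h \<odot> e X = k \<odot> e X"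
  shows "h = k"
proof -
  have "k \<odot> e X \<in> hom C X A" using assms by (simp add: hom_def)
  from free_ex1[OF assms(1) this] show ?thesis using assms by blast
qed

text \<open>Pairing \<open>h\<close> with the morphism \<open>k\<close> that it consults turns
  primitive recursion into plain iteration, on a product algebra whose first component ignores
  \<open>B\<close>.\<close>

lemma primitive_recursion_hom:
  assumes "a \<in> hom C (So A) A" "r \<in> hom C (So (Pr A B)) B" "X \<in> Obj C"
    and "k \<in> hom C (Fo X) A" "k \<odot> s X = a \<odot> Sa k"
    and "h \<in> hom C (Fo X) B" "h \<odot> s X = r \<odot> Sa (tuple k h)"
  shows "tuple k h \<odot> s X = tuple (a \<odot> Sa (p1 A B)) r \<odot> Sa (tuple k h)"
proof -
  have [simp]: "A \<in> Obj C" "B \<in> Obj C" using assms hom_Obj by blast+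
  note [simp] = assms(1,2,4,6)[unfolded hom_def, simplified] assms(3)
  have "Sa (p1 A B) \<odot> Sa (tuple k h) = Sa k" by (simp add: S.map_Comp[symmetric])
  then show ?thesis
    by (simp add: tuple_Comp assms(5,7))
qed

text \<open>The paired maps are algebra morphisms agreeing on generators, hence equal, and so are
  their second components. The morphism \<open>k\<close> is kept general because the recursions
  below run along an evaluation and along \<open>Fa t\<close>, not along the identity.\<close>

lemma primitive_recursion_eq:
  assumes "a \<in> hom C (So A) A" "r \<in> hom C (So (Pr A B)) B" "X \<in> Obj C"
    and "k \<in> hom C (Fo X) A" "k \<odot> s X = a \<odot> Sa k"
    and "h \<in> hom C (Fo X) B" "h \<odot> s X = r \<odot> Sa (tuple k h)"
    and "h' \<in> hom C (Fo X) B" "h' \<odot> s X = r \<odot> Sa (tuple k h')"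
    and "h \<odot> e X = h' \<odot> e X"
  shows "h = h'"
proof -
  have [simp]: "A \<in> Obj C" "B \<in> Obj C" using assms hom_Obj by blast+
  note [simp] = assms(1,2,4,6,8)[unfolded hom_def, simplified] assms(3)
  have "tuple k h = tuple k h'"
  proof (rule free_eq)
    show "tuple (a \<odot> Sa (p1 A B)) r \<in> hom C (So (Pr A B)) (Pr A B)" by (simp add: hom_def)
    show "tuple k h \<odot> e X = tuple k h' \<odot> e X" by (simp add: tuple_Comp assms(10))
  qed (simp_all add: hom_def primitive_recursion_hom[OF assms(1-7)]
      primitive_recursion_hom[OF assms(1-5,8,9)])
  then have "p2 A B \<odot> tuple k h = p2 A B \<odot> tuple k h'" by simp
  then show ?thesis by simp
qed

text \<open>As for natural numbers: iterate on pairs of a term and a value, then check that the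
  first component rebuilds the term itself, being an algebra endomorphism that fixes the
  generators.\<close>

lemma primitive_recursion_ex:
  assumes "r \<in> hom C (So (Pr (Fo X) B)) B" "g \<in> hom C X B"
  obtains h where "h \<in> hom C (Fo X) B" "h \<odot> s X = r \<odot> Sa (tuple (Id C (Fo X)) h)" "h \<odot> e X = g"
proof -
  have [simp]: "X \<in> Obj C" "B \<in> Obj C" using assms hom_Obj by blast+
  let ?A = "Fo X" and ?a = "tuple (s X \<odot> Sa (p1 (Fo X) B)) r"
  obtain h where h: "h \<in> hom C (Fo X) (Pr ?A B)" "h \<odot> s X = ?a \<odot> Sa h" "h \<odot> e X = tuple (e X) g"
    using free_ex1[of ?a "Pr ?A B" "tuple (e X) g" X] assms by (auto simp: hom_def)
  have "p1 ?A B \<odot> h = Id C (Fo X)"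
  proof (rule free_eq)
    show "(p1 ?A B \<odot> h) \<odot> s X = s X \<odot> Sa (p1 ?A B \<odot> h)"
      using h assms by (simp add: hom_def S.map_Comp)
    show "(p1 ?A B \<odot> h) \<odot> e X = Id C (Fo X) \<odot> e X"
      using h assms by (simp add: hom_def)
  qed (use h assms in \<open>auto simp: hom_def\<close>)
  then have t: "h = tuple (Id C (Fo X)) (p2 ?A B \<odot> h)"
    using h by (intro tuple_eqI) (auto simp: hom_def)
  have "(p2 ?A B \<odot> h) \<odot> s X = r \<odot> Sa h" and e: "(p2 ?A B \<odot> h) \<odot> e X = g"
    using h assms by (simp_all add: hom_def)
  note this(1)
  also have "r \<odot> Sa h = r \<odot> Sa (tuple (Id C (Fo X)) (p2 ?A B \<odot> h))"
    using t by (rule arg_cong)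
  finally have r: "(p2 ?A B \<odot> h) \<odot> s X = r \<odot> Sa (tuple (Id C (Fo X)) (p2 ?A B \<odot> h))" .
  have "p2 ?A B \<odot> h \<in> hom C (Fo X) B" using h(1) by (simp add: hom_def)
  from this r e show thesis by (rule that)
qed

end

section \<open>Congruence of the trace morphism\<close>

definition final_coalgebra where
  "final_coalgebra C Fo Fa Z z \<longleftrightarrow> Z \<in> Obj C \<and> z \<in> hom C Z (Fo Z) \<and>
     (\<forall>X. \<forall>c \<in> hom C X (Fo X). \<exists>!h. h \<in> hom C X Z \<and> Fa h \<odot>\<^bsub>C\<^esub> c = z \<odot>\<^bsub>C\<^esub> h)"

text \<open>An abstraction of the Kleisli category. \<open>Fa\<close> is pinned down by freeness,
  and naturality of \<open>\<rho>\<close> stays outside the locale since it may fail at a general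
  Kleisli morphism; it is imposed one morphism at a time through \<open>natural_at\<close>.\<close>

locale gsos = free_algebras C Pr p1 p2 So Sa Fo s e + B: endofunctor C Bo Ba
  for C :: "('o, 'm, 'x) category_scheme" (structure) and Pr p1 p2 So Sa Fo s e Bo Ba +
  fixes Fa \<rho>
  assumes Fa: "f \<in> Arr C \<Longrightarrow> Fa f \<in> hom C (Fo (Dom C f)) (Fo (Cod C f))"
    "f \<in> Arr C \<Longrightarrow> Fa f \<odot> s (Dom C f) = s (Cod C f) \<odot> Sa (Fa f)"
    "f \<in> Arr C \<Longrightarrow> Fa f \<odot> e (Dom C f) = e (Cod C f) \<odot> f"
    and \<rho>: "X \<in> Obj C \<Longrightarrow> \<rho> X \<in> hom C (So (Pr X (Bo X))) (Bo (Fo X))"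
begin

text \<open>Naturality at \<open>f\<close> is only ever applied after a pairing \<open>\<langle>id, c\<rangle>\<close>.\<close>

definition natural_at where
  "natural_at f \<longleftrightarrow> (\<forall>c \<in> hom C (Dom C f) (Bo (Dom C f)).
     \<rho> (Cod C f) \<odot> Sa (tuple f (Ba f \<odot> c)) =
     Ba (Fa f) \<odot> \<rho> (Dom C f) \<odot> Sa (tuple (Id C (Dom C f)) c))"

lemma Fa_simps [simp]:
  assumes "f \<in> Arr C"
  shows "Fa f \<in> Arr C" "Dom C (Fa f) = Fo (Dom C f)" "Cod C (Fa f) = Fo (Cod C f)"
  using Fa[OF assms] by (auto simp: hom_def)

lemma \<rho>_simps [simp]:
  assumes "X \<in> Obj C"
  shows "\<rho> X \<in> Arr C" "Dom C (\<rho> X) = So (Pr X (Bo X))" "Cod C (\<rho> X) = Bo (Fo X)"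
  using \<rho>[OF assms] by (auto simp: hom_def)

text \<open>The behaviour of a composite term: \<open>\<rho>\<close> turns the arguments and their
  behaviours into successors that are terms over terms, and \<open>m\<close> flattens them. In both
  uses \<open>m\<close> is the free monad multiplication.\<close>

lemma coalgebra_on_free:
  assumes "x \<in> hom C X (Bo X)" "m \<in> hom C (Fo (Fo X)) (Fo X)"
  obtains c where "c \<in> hom C (Fo X) (Bo (Fo X))"
    "c \<odot> s X = Ba m \<odot> \<rho> (Fo X) \<odot> Sa (tuple (Id C (Fo X)) c)" "c \<odot> e X = Ba (e X) \<odot> x"
proof -
  have [simp]: "X \<in> Obj C" using assms hom_Obj by blast
  show thesis
  proof (rule primitive_recursion_ex[of "Ba m \<odot> \<rho> (Fo X)" X "Bo (Fo X)" "Ba (e X) \<odot> x"])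
    fix c
    assume c: "c \<in> hom C (Fo X) (Bo (Fo X))"
      "c \<odot> s X = (Ba m \<odot> \<rho> (Fo X)) \<odot> Sa (tuple (Id C (Fo X)) c)" "c \<odot> e X = Ba (e X) \<odot> x"
    show thesis
    proof (rule that[OF c(1) _ c(3)])
      show "c \<odot> s X = Ba m \<odot> \<rho> (Fo X) \<odot> Sa (tuple (Id C (Fo X)) c)"
        unfolding c(2) using c(1) assms by (simp add: hom_def)
    qed
  next
    show "Ba m \<odot> \<rho> (Fo X) \<in> hom C (So (Pr (Fo X) (Bo (Fo X)))) (Bo (Fo X))"
      using assms(2) by (simp add: hom_def)
  next
    show "Ba (e X) \<odot> x \<in> hom C X (Bo (Fo X))"
      using assms(1) by (simp add: hom_def)
  qed
qed

lemma multiplication: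
  assumes "X \<in> Obj C"
  obtains m where "m \<in> hom C (Fo (Fo X)) (Fo X)" "m \<odot> s (Fo X) = s X \<odot> Sa m"
    "m \<odot> e (Fo X) = Id C (Fo X)"
  using free_ex1[of "s X" "Fo X" "Id C (Fo X)" "Fo X"] assms by (auto simp: hom_def)

theorem trace_congruence:
  assumes final: "final_coalgebra C Bo Ba Z z"
    and i: "i \<in> hom C (So I) I"
    and k: "k \<in> hom C (Fo I) I" "k \<odot> s I = i \<odot> Sa k" "k \<odot> e I = Id C I"
    and g: "g \<in> hom C I (Bo I)" "g \<odot> i = Ba k \<odot> \<rho> I \<odot> Sa (tuple (Id C I) g)"
    and t: "t \<in> hom C I Z" "Ba t \<odot> g = z \<odot> t"
    and nat: "natural_at k" "natural_at (Fa t)"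
  shows "\<exists>a \<in> hom C (So Z) Z. t \<odot> i = a \<odot> Sa t"
proof -
  have Obj [simp]: "I \<in> Obj C" "Z \<in> Obj C" using t(1) hom_Obj by blast+
  have z: "z \<in> hom C Z (Bo Z)" using final by (simp add: final_coalgebra_def)
  obtain m where m: "m \<in> hom C (Fo (Fo Z)) (Fo Z)" "m \<odot> s (Fo Z) = s Z \<odot> Sa m"
    "m \<odot> e (Fo Z) = Id C (Fo Z)" by (rule multiplication[OF Obj(2)])
  obtain n where n: "n \<in> hom C (Fo (Fo I)) (Fo I)" "n \<odot> s (Fo I) = s I \<odot> Sa n"
    "n \<odot> e (Fo I) = Id C (Fo I)" by (rule multiplication[OF Obj(1)])
  obtain c where c: "c \<in> hom C (Fo Z) (Bo (Fo Z))"
    "c \<odot> s Z = Ba m \<odot> \<rho> (Fo Z) \<odot> Sa (tuple (Id C (Fo Z)) c)" "c \<odot> e Z = Ba (e Z) \<odot> z"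
    by (rule coalgebra_on_free[OF z m(1)])
  obtain d where d: "d \<in> hom C (Fo I) (Bo (Fo I))"
    "d \<odot> s I = Ba n \<odot> \<rho> (Fo I) \<odot> Sa (tuple (Id C (Fo I)) d)" "d \<odot> e I = Ba (e I) \<odot> g"
    by (rule coalgebra_on_free[OF g(1) n(1)])
  note [simp] = z[unfolded hom_def, simplified] i[unfolded hom_def, simplified]
    k(1)[unfolded hom_def, simplified] g(1)[unfolded hom_def, simplified]
    t(1)[unfolded hom_def, simplified] m(1)[unfolded hom_def, simplified]
    n(1)[unfolded hom_def, simplified] c(1)[unfolded hom_def, simplified]
    d(1)[unfolded hom_def, simplified]
  have Ft: "Fa t \<odot> s I = s Z \<odot> Sa (Fa t)" "Fa t \<odot> e I = e Z \<odot> t"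
    using Fa(2,3)[of t] by simp_all
  have FFt: "Fa (Fa t) \<odot> s (Fo I) = s (Fo Z) \<odot> Sa (Fa (Fa t))"
    "Fa (Fa t) \<odot> e (Fo I) = e (Fo Z) \<odot> Fa t"
    using Fa(2,3)[of "Fa t"] by simp_all
  have Fk: "Fa k \<odot> s (Fo I) = s I \<odot> Sa (Fa k)" "Fa k \<odot> e (Fo I) = e I \<odot> k"
    using Fa(2,3)[of k] by simp_all
  \<comment> \<open>The equations of \<open>E\<close> are repeated in \<open>R\<close> in a form
    that rewrites inside right-associated composites.\<close>
  note R = Comp_reassoc[OF Ft(1)] Comp_reassoc[OF Ft(2)] Comp_reassoc[OF FFt(1)]
    Comp_reassoc[OF FFt(2)] Comp_reassoc[OF Fk(1)] Comp_reassoc[OF Fk(2)]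
    Comp_reassoc[OF k(2)] Comp_reassoc[OF k(3)] Comp_reassoc[OF g(2)] Comp_reassoc[OF t(2)]
    Comp_reassoc[OF m(2)] Comp_reassoc[OF m(3)] Comp_reassoc[OF n(2)] Comp_reassoc[OF n(3)]
    Comp_reassoc[OF c(2)] Comp_reassoc[OF c(3)] Comp_reassoc[OF d(2)] Comp_reassoc[OF d(3)]
    and E = Ft FFt Fk k(2,3) g(2) t(2) m(2,3) n(2,3) c(2,3) d(2,3)
  \<comment> \<open>\<open>k\<close> is an algebra for the free monad: both sides are algebra
    morphisms that restrict to \<open>k\<close> on generators.\<close>
  have kn: "k \<odot> n = k \<odot> Fa k"
    by (rule free_eq[OF i, of "Fo I"]) (simp_all add: hom_def S.map_Comp R E)
  \<comment> \<open>Naturality of the multiplication at \<open>t\<close>; both sides restrict to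
    \<open>Fa t\<close> on generators.\<close>
  have tn: "Fa t \<odot> n = m \<odot> Fa (Fa t)"
    by (rule free_eq[of "s Z" "Fo Z" "Fo I"]) (simp_all add: hom_def S.map_Comp R E)
  \<comment> \<open>Both sides solve the same primitive recursion along \<open>k\<close>, with value
    \<open>g\<close> on generators.\<close>
  have gk: "g \<odot> k = Ba k \<odot> d"
  proof (rule primitive_recursion_eq[OF i _ _ k(1,2), of "Ba k \<odot> \<rho> I"])
    have "(g \<odot> k) \<odot> s I = Ba k \<odot> \<rho> I \<odot> Sa (tuple (Id C I) g \<odot> k)"
      by (simp add: R E S.map_Comp)
    then show "(g \<odot> k) \<odot> s I = (Ba k \<odot> \<rho> I) \<odot> Sa (tuple k (g \<odot> k))"
      by (simp add: tuple_Comp)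
    \<comment> \<open>\<open>kn\<close> trades the flattening \<open>n\<close> for
      \<open>Fa k\<close>, the shape in which naturality of \<open>\<rho>\<close> at
      \<open>k\<close> applies.\<close>
    have "(Ba k \<odot> d) \<odot> s I = Ba (k \<odot> n) \<odot> \<rho> (Fo I) \<odot> Sa (tuple (Id C (Fo I)) d)"
      by (simp add: R E B.map_Comp)
    also have "\<dots> = Ba k \<odot> Ba (Fa k) \<odot> \<rho> (Fo I) \<odot> Sa (tuple (Id C (Fo I)) d)"
      by (simp add: kn B.map_Comp)
    also have "\<dots> = (Ba k \<odot> \<rho> I) \<odot> Sa (tuple k (Ba k \<odot> d))"
      using nat(1) d(1) by (simp add: natural_at_def)
    finally show "(Ba k \<odot> d) \<odot> s I = (Ba k \<odot> \<rho> I) \<odot> Sa (tuple k (Ba k \<odot> d))" .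
    have "(Ba k \<odot> d) \<odot> e I = Ba (k \<odot> e I) \<odot> g"
      unfolding B.map_Comp[of "e I" k, simplified] by (simp add: E)
    then show "(g \<odot> k) \<odot> e I = (Ba k \<odot> d) \<odot> e I" by (simp add: E)
  qed (simp_all add: hom_def)
  \<comment> \<open>The same argument along \<open>Fa t\<close>, with \<open>tn\<close> in the role
    of \<open>kn\<close> and naturality at \<open>Fa t\<close> in that of naturality at
    \<open>k\<close>.\<close>
  have ct: "c \<odot> Fa t = Ba (Fa t) \<odot> d"
  proof (rule primitive_recursion_eq[of "s Z" "Fo Z" "Ba m \<odot> \<rho> (Fo Z)" _ I "Fa t"])
    have "(c \<odot> Fa t) \<odot> s I = Ba m \<odot> \<rho> (Fo Z) \<odot> Sa (tuple (Id C (Fo Z)) c \<odot> Fa t)"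
      by (simp add: R E S.map_Comp)
    then show "(c \<odot> Fa t) \<odot> s I = (Ba m \<odot> \<rho> (Fo Z)) \<odot> Sa (tuple (Fa t) (c \<odot> Fa t))"
      by (simp add: tuple_Comp)
    have "(Ba (Fa t) \<odot> d) \<odot> s I =
        Ba (Fa t \<odot> n) \<odot> \<rho> (Fo I) \<odot> Sa (tuple (Id C (Fo I)) d)"
      by (simp add: R E B.map_Comp)
    also have "\<dots> = Ba m \<odot> Ba (Fa (Fa t)) \<odot> \<rho> (Fo I) \<odot> Sa (tuple (Id C (Fo I)) d)"
      by (simp add: tn B.map_Comp)
    also have "\<dots> = (Ba m \<odot> \<rho> (Fo Z)) \<odot> Sa (tuple (Fa t) (Ba (Fa t) \<odot> d))"
      using nat(2) d(1) by (simp add: natural_at_def)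
    finally show "(Ba (Fa t) \<odot> d) \<odot> s I =
      (Ba m \<odot> \<rho> (Fo Z)) \<odot> Sa (tuple (Fa t) (Ba (Fa t) \<odot> d))" .
    have "(Ba (Fa t) \<odot> d) \<odot> e I = Ba (Fa t \<odot> e I) \<odot> g"
      unfolding B.map_Comp[of "e I" "Fa t", simplified] by (simp add: E)
    also have "\<dots> = Ba (e Z) \<odot> Ba t \<odot> g" by (simp add: E B.map_Comp)
    also have "\<dots> = (c \<odot> Fa t) \<odot> e I" by (simp add: E R)
    finally show "(c \<odot> Fa t) \<odot> e I = (Ba (Fa t) \<odot> d) \<odot> e I" ..
  qed (simp_all add: hom_def E)
  obtain b where b: "b \<in> hom C (Fo Z) Z" "Ba b \<odot> c = z \<odot> b"
    using final c(1) unfolding final_coalgebra_def by blast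
  note [simp] = b(1)[unfolded hom_def, simplified]
  have "t \<odot> k = b \<odot> Fa t"
  proof -
    have "\<exists>!h. h \<in> hom C (Fo I) Z \<and> Ba h \<odot> d = z \<odot> h"
      using final d(1) unfolding final_coalgebra_def by blast
    moreover have "Ba (t \<odot> k) \<odot> d = z \<odot> t \<odot> k"
      by (simp add: B.map_Comp gk[symmetric] Comp_reassoc[OF t(2)])
    moreover have "Ba (b \<odot> Fa t) \<odot> d = z \<odot> b \<odot> Fa t"
      by (simp add: B.map_Comp ct[symmetric] Comp_reassoc[OF b(2)])
    moreover have "t \<odot> k \<in> hom C (Fo I) Z" "b \<odot> Fa t \<in> hom C (Fo I) Z"
      by (simp_all add: hom_def)
    ultimately show ?thesis by blast
  qed
  \<comment> \<open>Since \<open>k \<odot> e I\<close> is the identity, \<open>i\<close> equals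
    \<open>k\<close> after the insertion \<open>s I \<odot> Sa (e I)\<close> of depth-one terms,
    which brings \<open>t \<odot> k = b \<odot> Fa t\<close> into play.\<close>
  have "t \<odot> i = t \<odot> i \<odot> Sa (k \<odot> e I)" by (simp add: k(3))
  also have "\<dots> = (t \<odot> k) \<odot> s I \<odot> Sa (e I)"
    by (simp add: S.map_Comp Comp_reassoc[OF k(2)])
  also have "\<dots> = b \<odot> s Z \<odot> Sa (Fa t \<odot> e I)"
    by (simp add: \<open>t \<odot> k = b \<odot> Fa t\<close> S.map_Comp R)
  also have "\<dots> = (b \<odot> s Z \<odot> Sa (e Z)) \<odot> Sa t" by (simp add: S.map_Comp E)
  finally show ?thesis
    by (intro bexI[of _ "b \<odot> s Z \<odot> Sa (e Z)"]) (simp_all add: hom_def)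
qed

end

section \<open>Final coalgebras from initial algebras\<close>

text \<open>Transfinite iteration of \<open>f\<close> from the least element, encoded without
  ordinals: that a point lies in every closed set is an induction principle for this point.\<close>

definition iteration_closed ::
  "'a set \<Rightarrow> ('a \<Rightarrow> 'a \<Rightarrow> bool) \<Rightarrow> ('a \<Rightarrow> 'a) \<Rightarrow> 'a set \<Rightarrow> bool" where
  "iteration_closed A le f Q \<longleftrightarrow> (\<forall>b. is_least_on A le b \<longrightarrow> b \<in> Q) \<and>
    (\<forall>y. y \<in> A \<longrightarrow> y \<in> Q \<longrightarrow> f y \<in> Q) \<and>
    (\<forall>D s. directed_in A le D \<longrightarrow> D \<subseteq> Q \<longrightarrow> is_lub_on A le D s \<longrightarrow> s \<in> Q)"

text \<open>Pataraia's proof: the monotone inflationary self-maps of the least subset closed under \<open>f\<close>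
  and directed joins are themselves directed, and the value of their join at \<open>\<bottom>\<close> is a fixed point.\<close>

lemma dcpo_fixpoint:
  assumes dcpo: "pointed_dcpo_on A le"
    and f: "\<And>x. x \<in> A \<Longrightarrow> f x \<in> A"
    and mono: "\<And>x y. \<lbrakk>x \<in> A; y \<in> A; le x y\<rbrakk> \<Longrightarrow> le (f x) (f y)"
  obtains x where "x \<in> A" "f x = x"
    "\<forall>Q. iteration_closed A le f Q \<longrightarrow> x \<in> Q"
proof -
  have refl: "le x x" if "x \<in> A" for x
    using dcpo that by (simp add: pointed_dcpo_on_def reflp_on_def)
  have trans: "le x z" if "x \<in> A" "y \<in> A" "z \<in> A" "le x y" "le y z" for x y z
    using dcpo that unfolding pointed_dcpo_on_def transp_on_def by blast
  have antisym: "x = y" if "x \<in> A" "y \<in> A" "le x y" "le y x" for x y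
    using dcpo that unfolding pointed_dcpo_on_def antisymp_on_def by blast
  have lub: "\<exists>s. is_lub_on A le D s" if "directed_in A le D" for D
    using dcpo that unfolding pointed_dcpo_on_def by blast
  obtain bot where bot: "is_least_on A le bot"
    using dcpo unfolding pointed_dcpo_on_def by blast
  let ?closed = "iteration_closed A le f"
  \<comment> \<open>\<open>P\<close> stands for the stages of the iteration. On it \<open>f\<close>
    is inflationary, because the points below their own image form a closed set; on all of
    \<open>A\<close> this may fail.\<close>
  define P where "P = \<Inter>{Q. ?closed Q}"
  have P_sub: "P \<subseteq> Q" if "?closed Q" for Q using that by (auto simp: P_def)
  have P_closed: "?closed P"
    unfolding iteration_closed_def
  proof (intro conjI allI impI)
    show "b \<in> P" if "is_least_on A le b" for b
      using that by (auto simp: P_def iteration_closed_def)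
    show "f y \<in> P" if "y \<in> A" "y \<in> P" for y
      using that by (auto simp: P_def iteration_closed_def)
    show "s \<in> P" if D: "directed_in A le D" "D \<subseteq> P" "is_lub_on A le D s" for D s
      unfolding P_def
    proof (intro InterI, clarify)
      fix Q assume Q: "?closed Q"
      then have "D \<subseteq> Q" using D(2) P_sub by blast
      then show "s \<in> Q" using Q D(1,3) unfolding iteration_closed_def by blast
    qed
  qed
  have "?closed A" using f by (auto simp: iteration_closed_def is_least_on_def is_lub_on_def)
  then have PA: "P \<subseteq> A" by (rule P_sub)
  have "?closed {x \<in> A. le x (f x)}"
    unfolding iteration_closed_def
  proof (intro conjI allI impI)
    show "b \<in> {x \<in> A. le x (f x)}" if "is_least_on A le b" for b
      using that f by (auto simp: is_least_on_def)
    show "f y \<in> {x \<in> A. le x (f x)}" if "y \<in> A" "y \<in> {x \<in> A. le x (f x)}" for y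
      using that f mono by auto
    show "s \<in> {x \<in> A. le x (f x)}"
      if D: "directed_in A le D" "D \<subseteq> {x \<in> A. le x (f x)}" "is_lub_on A le D s" for D s
    proof -
      have s: "s \<in> A" using D(3) by (simp add: is_lub_on_def)
      have "le x (f s)" if "x \<in> D" for x
      proof -
        have "x \<in> A" "le x (f x)" "le x s" using D that by (auto simp: is_lub_on_def)
        then show ?thesis using trans[of x "f x" "f s"] f mono s by blast
      qed
      then show ?thesis using D(3) f s by (auto simp: is_lub_on_def)
    qed
  qed
  then have infl: "le x (f x)" if "x \<in> P" for x using P_sub that by blast
  define E where "E = {g. (\<forall>x \<in> P. g x \<in> P \<and> le x (g x)) \<and>
    (\<forall>x \<in> P. \<forall>y \<in> P. le x y \<longrightarrow> le (g x) (g y))}"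
  have id_E: "id \<in> E" using refl PA by (auto simp: E_def)
  have comp_E: "g \<circ> h \<in> E" if "g \<in> E" "h \<in> E" for g h
    using that PA trans unfolding E_def by (auto, meson subsetD)
  have f_E: "f \<in> E" using infl mono PA P_closed by (auto simp: E_def iteration_closed_def)
  have dir: "directed_in A le ((\<lambda>g. g x) ` E)" if "x \<in> P" for x
    unfolding directed_in_def
  proof (intro conjI ballI)
    show "(\<lambda>g. g x) ` E \<noteq> {}" using id_E by blast
    show "(\<lambda>g. g x) ` E \<subseteq> A" using that PA by (auto simp: E_def)
    fix u v assume "u \<in> (\<lambda>g. g x) ` E" "v \<in> (\<lambda>g. g x) ` E"
    then obtain g h where "g \<in> E" "h \<in> E" "u = g x" "v = h x" by blast
    \<comment> \<open>\<open>g \<circ> h\<close> dominates \<open>h\<close> since \<open>g\<close>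
      is inflationary, and dominates \<open>g\<close> since \<open>h\<close> is inflationary and
      \<open>g\<close> monotone.\<close>
    moreover from this have "le (g x) ((g \<circ> h) x)" "le (h x) ((g \<circ> h) x)"
      using that by (auto simp: E_def)
    ultimately show "\<exists>z \<in> (\<lambda>g. g x) ` E. le u z \<and> le v z" using comp_E by blast
  qed
  define t where "t x = (SOME s. is_lub_on A le ((\<lambda>g. g x) ` E) s)" for x
  have t: "is_lub_on A le ((\<lambda>g. g x) ` E) (t x)" if "x \<in> P" for x
    using someI_ex[OF lub[OF dir[OF that]]] by (simp add: t_def)
  have tP: "t x \<in> P" if "x \<in> P" for x
  proof -
    have "(\<lambda>g. g x) ` E \<subseteq> P" using that by (auto simp: E_def)
    then show ?thesis using P_closed dir[OF that] t[OF that] by (simp add: iteration_closed_def)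
  qed
  have t_ge: "le (g x) (t x)" if "g \<in> E" "x \<in> P" for g x
    using t[OF that(2)] that(1) by (auto simp: is_lub_on_def)
  have "t \<in> E"
    unfolding E_def
  proof (intro CollectI conjI ballI impI)
    show "t x \<in> P" if "x \<in> P" for x using tP that .
    show "le x (t x)" if "x \<in> P" for x using t_ge[OF id_E that] by simp
    show "le (t x) (t y)" if "x \<in> P" "y \<in> P" "le x y" for x y
    proof -
      have "le (g x) (t y)" if "g \<in> E" for g
        using trans[of "g x" "g y" "t y"] t_ge[OF that \<open>y \<in> P\<close>] that \<open>x \<in> P\<close> \<open>y \<in> P\<close> \<open>le x y\<close>
          PA tP by (auto simp: E_def)
      then show ?thesis
        using t[OF \<open>x \<in> P\<close>] tP[OF \<open>y \<in> P\<close>] PA by (auto simp: is_lub_on_def)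
    qed
  qed
  have "bot \<in> P" using bot P_closed by (simp add: iteration_closed_def)
  \<comment> \<open>\<open>t\<close> is the greatest element of \<open>E\<close>, and
    \<open>f \<circ> t\<close> again belongs to \<open>E\<close>, so it lies below
    \<open>t\<close>.\<close>
  then have "le (f (t bot)) (t bot)"
    using t_ge[OF comp_E[OF f_E \<open>t \<in> E\<close>]] by auto
  moreover have "le (t bot) (f (t bot))" using infl tP \<open>bot \<in> P\<close> by blast
  ultimately have "f (t bot) = t bot" using antisym f tP[OF \<open>bot \<in> P\<close>] PA by blast
  then show thesis
  proof (rule that[rotated])
    show "t bot \<in> A" using tP \<open>bot \<in> P\<close> PA by blast
    show "\<forall>Q. ?closed Q \<longrightarrow> t bot \<in> Q" using P_sub tP \<open>bot \<in> P\<close> by blast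
  qed
qed

locale dcpo_enriched = category +
  fixes le
  assumes dcpo: "\<lbrakk>X \<in> Obj C; Y \<in> Obj C\<rbrakk> \<Longrightarrow> pointed_dcpo_on (hom C X Y) (le X Y)"
    and join_right: "\<lbrakk>X \<in> Obj C; Y \<in> Obj C; Z \<in> Obj C; g \<in> hom C Y Z;
        directed_in (hom C X Y) (le X Y) D; is_lub_on (hom C X Y) (le X Y) D s\<rbrakk> \<Longrightarrow>
      is_lub_on (hom C X Z) (le X Z) ((\<lambda>f. g \<odot> f) ` D) (g \<odot> s)"
    and join_left: "\<lbrakk>X \<in> Obj C; Y \<in> Obj C; Z \<in> Obj C; f \<in> hom C X Y;
        directed_in (hom C Y Z) (le Y Z) D; is_lub_on (hom C Y Z) (le Y Z) D s\<rbrakk> \<Longrightarrow>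
      is_lub_on (hom C X Z) (le X Z) ((\<lambda>g. g \<odot> f) ` D) (s \<odot> f)"
    and bot_left: "\<lbrakk>X \<in> Obj C; Y \<in> Obj C; Z \<in> Obj C; f \<in> hom C X Y;
        is_least_on (hom C Y Z) (le Y Z) b\<rbrakk> \<Longrightarrow> is_least_on (hom C X Z) (le X Z) (b \<odot> f)"
begin

lemma le_refl: "f \<in> hom C X Y \<Longrightarrow> le X Y f f"
  using dcpo[of X Y] hom_Obj by (auto simp: pointed_dcpo_on_def reflp_on_def)

text \<open>Through such two-element sets, preservation of directed joins yields monotonicity of
  composition.\<close>

lemma directed_pair:
  assumes "f \<in> hom C X Y" "g \<in> hom C X Y" "le X Y f g"
  shows "directed_in (hom C X Y) (le X Y) {f, g}" "is_lub_on (hom C X Y) (le X Y) {f, g} g"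
  using assms le_refl by (auto simp: directed_in_def is_lub_on_def)

lemma Comp_mono:
  assumes "f \<in> hom C X Y" "g \<in> hom C X Y" "le X Y f g"
  shows Comp_mono_right: "h \<in> hom C Y Z \<Longrightarrow> le X Z (h \<odot> f) (h \<odot> g)"
    and Comp_mono_left: "k \<in> hom C W X \<Longrightarrow> le W Y (f \<odot> k) (g \<odot> k)"
proof -
  have [simp]: "X \<in> Obj C" "Y \<in> Obj C" using assms(1) hom_Obj by blast+
  show "le X Z (h \<odot> f) (h \<odot> g)" if "h \<in> hom C Y Z"
    using join_right[OF _ _ _ that directed_pair[OF assms]] hom_Obj[OF that]
    by (auto simp: is_lub_on_def)
  show "le W Y (f \<odot> k) (g \<odot> k)" if "k \<in> hom C W X"
    using join_left[OF _ _ _ that directed_pair[OF assms]] hom_Obj[OF that]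
    by (auto simp: is_lub_on_def)
qed

text \<open>On \<open>Z\<close> itself, initiality makes \<open>id\<close> the only fixed point of \<open>g \<mapsto> b \<odot> Fa g \<odot> b'\<close>; precomposing
  its iteration with a coalgebra morphism \<open>h\<close> shows that \<open>h\<close> is the least one.\<close>

theorem initial_algebra_final_coalgebra:
  assumes F: "is_functor C C Fo Fa"
    and Fa_mono: "\<And>X Y f g. \<lbrakk>f \<in> hom C X Y; g \<in> hom C X Y; le X Y f g\<rbrakk> \<Longrightarrow>
      le (Fo X) (Fo Y) (Fa f) (Fa g)"
    and initial: "initial_algebra C Fo Fa Z b"
    and inverse: "is_inverse C b b'"
  shows "final_coalgebra C Fo Fa Z b'"
proof -
  interpret F: endofunctor C Fo Fa by unfold_locales (rule F)
  have b: "Z \<in> Obj C" "b \<in> hom C (Fo Z) Z" using initial by (auto simp: initial_algebra_def)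
  have b': "b' \<in> hom C Z (Fo Z)" "b' \<odot> b = Id C (Fo Z)" "b \<odot> b' = Id C Z"
    using inverse b by (auto simp: is_inverse_def hom_def)
  note [simp] = b(1) b(2)[unfolded hom_def, simplified] b'(1)[unfolded hom_def, simplified]
  have cancel [simp]: "b' \<odot> b \<odot> k = k" if "k \<in> Arr C" "Cod C k = Fo Z" for k
    using that by (simp add: Comp_reassoc[OF b'(2)])
  have cancel' [simp]: "b \<odot> b' \<odot> k = k" if "k \<in> Arr C" "Cod C k = Z" for k
    using that by (simp add: Comp_reassoc[OF b'(3)])
  define \<Psi> where "\<Psi> c h = b \<odot> Fa h \<odot> c" for c h
  have hom: "\<Psi> c h \<in> hom C X Z" if "c \<in> hom C X (Fo Y)" "h \<in> hom C Y Z" for c h X Y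
    using that by (simp add: \<Psi>_def hom_def)
  have mono: "le X Z (\<Psi> c h) (\<Psi> c k)"
    if "c \<in> hom C X (Fo X)" "h \<in> hom C X Z" "k \<in> hom C X Z" "le X Z h k" for c h k X
  proof -
    have "Fa h \<in> hom C (Fo X) (Fo Z)" "Fa k \<in> hom C (Fo X) (Fo Z)"
      using that by (simp_all add: hom_def)
    moreover from this have "le X (Fo Z) (Fa h \<odot> c) (Fa k \<odot> c)"
      using Fa_mono that by (intro Comp_mono_left[where X="Fo X"]) auto
    ultimately show ?thesis
      unfolding \<Psi>_def using that b by (intro Comp_mono_right[where Y="Fo Z"]) (auto intro: Comp_hom)
  qed
  \<comment> \<open>Cancelling the isomorphism \<open>b\<close> turns coalgebra morphisms into fixed
    points, to which the order-theoretic argument applies.\<close>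
  have fix_iff: "Fa h \<odot> c = b' \<odot> h \<longleftrightarrow> \<Psi> c h = h"
    if "c \<in> hom C X (Fo X)" "h \<in> hom C X Z" for c h X
  proof
    assume "Fa h \<odot> c = b' \<odot> h"
    then show "\<Psi> c h = h" using that by (simp add: \<Psi>_def hom_def)
  next
    assume "\<Psi> c h = h"
    then have "b' \<odot> h = b' \<odot> b \<odot> Fa h \<odot> c" by (simp only: \<Psi>_def)
    then show "Fa h \<odot> c = b' \<odot> h" using that by (simp add: hom_def)
  qed
  obtain j where j: "j \<in> hom C Z Z" "\<Psi> b' j = j"
    "\<forall>Q. iteration_closed (hom C Z Z) (le Z Z) (\<Psi> b') Q \<longrightarrow> j \<in> Q"
    by (rule dcpo_fixpoint[of "hom C Z Z" "le Z Z" "\<Psi> b'",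
          OF dcpo[OF b(1) b(1)] hom[OF b'(1)] mono[OF b'(1)]]) blast
  \<comment> \<open>A fixed point of \<open>\<Psi> b'\<close> is an endomorphism of the initial
    algebra, which forces \<open>j\<close> to be the identity.\<close>
  have "j \<odot> b = b \<odot> Fa j"
  proof -
    have "j \<odot> b = \<Psi> b' j \<odot> b" by (simp add: j(2))
    also have "\<dots> = b \<odot> Fa j" using j(1) by (simp add: \<Psi>_def hom_def b'(2))
    finally show ?thesis .
  qed
  moreover have "\<exists>!h. h \<in> hom C Z Z \<and> h \<odot> b = b \<odot> Fa h"
    using initial by (simp add: initial_algebra_def)
  moreover have "Id C Z \<in> hom C Z Z \<and> Id C Z \<odot> b = b \<odot> Fa (Id C Z)" by (simp add: hom_def)
  ultimately have j_Id: "j = Id C Z" using j(1) by blast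
  have "\<exists>!h. h \<in> hom C X Z \<and> Fa h \<odot> c = b' \<odot> h" if c: "c \<in> hom C X (Fo X)" for X c
  proof -
    have [simp]: "X \<in> Obj C" using c hom_Obj by blast
    obtain u where u: "u \<in> hom C X Z" "\<Psi> c u = u"
      by (rule dcpo_fixpoint[of "hom C X Z" "le X Z" "\<Psi> c",
            OF dcpo[OF _ b(1)] hom[OF c] mono[OF c]]) auto
    have below: "le X Z h k" if h: "h \<in> hom C X Z" "\<Psi> c h = h" and k: "k \<in> hom C X Z" "\<Psi> c k = k" for h k
    proof -
      \<comment> \<open>The invariant \<open>g \<odot> h \<le> k\<close> is carried from the least
        element to \<open>j\<close>: left strictness starts it,
        \<open>\<Psi> b' g \<odot> h = \<Psi> c (g \<odot> h)\<close> takes it through a step, and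
        preservation of joins on the left through a limit. At \<open>j\<close>, the identity, it
        reads \<open>h \<le> k\<close>.\<close>
      have "j \<in> {g. g \<in> hom C Z Z \<and> le X Z (g \<odot> h) k}"
      proof (rule j(3)[rule_format], unfold iteration_closed_def, intro conjI allI impI)
        fix l assume "is_least_on (hom C Z Z) (le Z Z) l"
        then show "l \<in> {g. g \<in> hom C Z Z \<and> le X Z (g \<odot> h) k}"
          using bot_left[of X Z Z h l] h(1) k(1) by (auto simp: is_least_on_def)
      next
        fix g assume g: "g \<in> hom C Z Z" "g \<in> {g. g \<in> hom C Z Z \<and> le X Z (g \<odot> h) k}"
        have "\<Psi> b' g \<odot> h = b \<odot> Fa g \<odot> b' \<odot> h"
          using g(1) h(1) by (simp add: \<Psi>_def hom_def)
        also have "b' \<odot> h = Fa h \<odot> c" using fix_iff[OF c h(1)] h(2) by simp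
        also have "b \<odot> Fa g \<odot> Fa h \<odot> c = \<Psi> c (g \<odot> h)"
          using g(1) h(1) c by (simp add: \<Psi>_def hom_def F.map_Comp)
        finally have "\<Psi> b' g \<odot> h = \<Psi> c (g \<odot> h)" .
        moreover have "le X Z (\<Psi> c (g \<odot> h)) (\<Psi> c k)"
          using g h(1) k(1) by (intro mono[OF c]) (auto intro: Comp_hom)
        ultimately show "\<Psi> b' g \<in> {g. g \<in> hom C Z Z \<and> le X Z (g \<odot> h) k}"
          using k(2) hom[OF b'(1) g(1)] by simp
      next
        fix D s
        assume D: "directed_in (hom C Z Z) (le Z Z) D" "D \<subseteq> {g. g \<in> hom C Z Z \<and> le X Z (g \<odot> h) k}"
          "is_lub_on (hom C Z Z) (le Z Z) D s"
        have "is_lub_on (hom C X Z) (le X Z) ((\<lambda>g. g \<odot> h) ` D) (s \<odot> h)"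
          using join_left[OF _ _ _ h(1) D(1,3)] by simp
        then show "s \<in> {g. g \<in> hom C Z Z \<and> le X Z (g \<odot> h) k}"
          using D(2,3) k(1) by (auto simp: is_lub_on_def)
      qed
      then show ?thesis using h(1) by (simp add: j_Id hom_def)
    qed
    have "h = k" if "h \<in> hom C X Z" "\<Psi> c h = h" "k \<in> hom C X Z" "\<Psi> c k = k" for h k
      using dcpo[of X Z] below that unfolding pointed_dcpo_on_def antisymp_on_def by simp
    then show ?thesis using u fix_iff[OF c] by blast
  qed
  then show ?thesis using b b' by (simp add: final_coalgebra_def)
qed

end

section \<open>The Kleisli category\<close>

context de_simone_setting
begin

sublocale T: endofunctor M "TO M" "TA M"
  by unfold_locales (use T in \<open>simp add: monad_def\<close>)

sublocale Sig: endofunctor M "SigO M" "SigA M"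
  by unfold_locales (rule Sig)

sublocale B: endofunctor M "BO M" "BA M"
  by unfold_locales (rule B)

sublocale P: products M "Prd M" "pr1 M" "pr2 M"
  by unfold_locales (rule Prd)

sublocale F: free_algebras M "Prd M" "pr1 M" "pr2 M" "SigO M" "SigA M" "StarO M" "star_op M" "star_unit M"
  by unfold_locales (rule Star)

lemma pair_tuple: "pair M f g = P.tuple f g"
  by (simp add: pair_def P.tuple_def)

lemma eta_mu_Arr [simp]:
  assumes "X \<in> Obj M"
  shows "eta M X \<in> Arr M" "Dom M (eta M X) = X" "Cod M (eta M X) = TO M X"
    "mu M X \<in> Arr M" "Dom M (mu M X) = TO M (TO M X)" "Cod M (mu M X) = TO M X"
  using T assms by (auto simp: monad_def hom_def)

lemma eta_natural:
  assumes "f \<in> Arr M" "Dom M f = X"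
  shows "TA M f \<odot> eta M X = eta M (Cod M f) \<odot> f"
    and "g \<in> Arr M \<Longrightarrow> Cod M g = X \<Longrightarrow> TA M f \<odot> eta M X \<odot> g = eta M (Cod M f) \<odot> f \<odot> g"
proof -
  have X: "X \<in> Obj M" using assms by auto
  show *: "TA M f \<odot> eta M X = eta M (Cod M f) \<odot> f"
    using T assms unfolding monad_def hom_def by blast
  show "TA M f \<odot> eta M X \<odot> g = eta M (Cod M f) \<odot> f \<odot> g" if "g \<in> Arr M" "Cod M g = X"
    using that assms X by (simp add: Comp_reassoc[OF *])
qed

lemma mu_natural:
  assumes "f \<in> Arr M" "Dom M f = X"
  shows "TA M f \<odot> mu M X = mu M (Cod M f) \<odot> TA M (TA M f)"
    and "g \<in> Arr M \<Longrightarrow> Cod M g = TO M (TO M X) \<Longrightarrow>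
      TA M f \<odot> mu M X \<odot> g = mu M (Cod M f) \<odot> TA M (TA M f) \<odot> g"
proof -
  have X: "X \<in> Obj M" using assms by auto
  show *: "TA M f \<odot> mu M X = mu M (Cod M f) \<odot> TA M (TA M f)"
    using T assms unfolding monad_def hom_def by blast
  show "TA M f \<odot> mu M X \<odot> g = mu M (Cod M f) \<odot> TA M (TA M f) \<odot> g"
    if "g \<in> Arr M" "Cod M g = TO M (TO M X)"
    using that assms X by (simp add: Comp_reassoc[OF *])
qed

lemma monad_laws [simp]:
  assumes "X \<in> Obj M"
  shows "mu M X \<odot> eta M (TO M X) = Id M (TO M X)"
    "mu M X \<odot> TA M (eta M X) = Id M (TO M X)"
    "mu M X \<odot> TA M (mu M X) = mu M X \<odot> mu M (TO M X)"
  using T assms by (auto simp: monad_def)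

lemma monad_laws_assoc [simp]:
  assumes "X \<in> Obj M" "g \<in> Arr M"
  shows "Cod M g = TO M X \<Longrightarrow> mu M X \<odot> eta M (TO M X) \<odot> g = g"
    "Cod M g = TO M X \<Longrightarrow> mu M X \<odot> TA M (eta M X) \<odot> g = g"
    "Cod M g = TO M (TO M (TO M X)) \<Longrightarrow> mu M X \<odot> TA M (mu M X) \<odot> g = mu M X \<odot> mu M (TO M X) \<odot> g"
  using assms by (simp_all add: Comp_reassoc[OF monad_laws(1)] Comp_reassoc[OF monad_laws(2)]
      Comp_reassoc[OF monad_laws(3)])

end

text \<open>Arrows carry their codomain, since it cannot be recovered from \<open>TO\<close> of it.\<close>

definition Kl :: "('o, 'm) setting \<Rightarrow> ('o, 'm \<times> 'o) category" where
  "Kl M = \<lparr>Obj = Obj M, Arr = {p. fst p \<in> Arr M \<and> snd p \<in> Obj M \<and> Cod M (fst p) = TO M (snd p)},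
     Dom = (\<lambda>p. Dom M (fst p)), Cod = snd, Id = (\<lambda>X. (eta M X, X)),
     Comp = (\<lambda>q p. (kcomp M (snd q) (fst q) (fst p), snd q))\<rparr>"

text \<open>Packs a Kleisli extension, which takes the codomain as an argument, as an arrow map on
  arrows tagged with their codomain.\<close>

definition lift ::
  "('o \<Rightarrow> 'o) \<Rightarrow> ('o \<Rightarrow> 'm \<Rightarrow> 'm) \<Rightarrow> 'm \<times> 'o \<Rightarrow> 'm \<times> 'o" where
  "lift Fo bar p = (bar (snd p) (fst p), Fo (snd p))"

definition JK :: "('o, 'm) setting \<Rightarrow> 'm \<Rightarrow> 'm \<times> 'o" where
  "JK M f = (J M f, Cod M f)"

lemma Kl_Obj [simp]: "Obj (Kl M) = Obj M"
  by (simp add: Kl_def)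

lemma Kl_sel:
  "Arr (Kl M) = {p. fst p \<in> Arr M \<and> snd p \<in> Obj M \<and> Cod M (fst p) = TO M (snd p)}"
  "Dom (Kl M) p = Dom M (fst p)" "Cod (Kl M) p = snd p" "Id (Kl M) X = (eta M X, X)"
  "q \<odot>\<^bsub>Kl M\<^esub> p = (kcomp M (snd q) (fst q) (fst p), snd q)"
  by (simp_all add: Kl_def)

lemma Kl_hom: "p \<in> hom (Kl M) X Y \<longleftrightarrow> fst p \<in> khom M X Y \<and> snd p = Y"
  by (auto simp: Kl_sel hom_def khom_def)

context de_simone_setting
begin

sublocale Kl: category "Kl M"
proof
  fix W X Y Z f g h
  assume "f \<in> hom (Kl M) W X" "g \<in> hom (Kl M) X Y" "h \<in> hom (Kl M) Y Z"
  then show "(h \<odot>\<^bsub>Kl M\<^esub> g) \<odot>\<^bsub>Kl M\<^esub> f = h \<odot>\<^bsub>Kl M\<^esub> g \<odot>\<^bsub>Kl M\<^esub> f"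
    by (auto simp: Kl_sel hom_def kcomp_def T.map_Comp mu_natural)
qed (auto simp: Kl_sel hom_def kcomp_def T.map_Comp eta_natural prod_eq_iff)

lemma distributive_lawD:
  assumes "distributive_law M Fo Fa d"
  shows "X \<in> Obj M \<Longrightarrow> d X \<in> Arr M" "X \<in> Obj M \<Longrightarrow> Dom M (d X) = Fo (TO M X)"
    "X \<in> Obj M \<Longrightarrow> Cod M (d X) = TO M (Fo X)"
    "f \<in> Arr M \<Longrightarrow> d (Cod M f) \<odot> Fa (TA M f) = TA M (Fa f) \<odot> d (Dom M f)"
    "X \<in> Obj M \<Longrightarrow> d X \<odot> Fa (eta M X) = eta M (Fo X)"
    "X \<in> Obj M \<Longrightarrow> d X \<odot> Fa (mu M X) = mu M (Fo X) \<odot> TA M (d X) \<odot> d (TO M X)"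
  using assms unfolding distributive_law_def by (auto simp: hom_def)

text \<open>Identities are preserved by the unit law of \<open>d\<close>, composites by its
  multiplication law followed by its naturality.\<close>

lemma lift_functor:
  assumes F: "is_functor M M Fo Fa" and d: "distributive_law M Fo Fa d"
  shows "is_functor (Kl M) (Kl M) Fo (lift Fo (\<lambda>X p. d X \<odot> Fa p))"
proof -
  interpret F: endofunctor M Fo Fa by unfold_locales (rule F)
  note [simp] = distributive_lawD(1-3)[OF d]
  have comp: "d Z \<odot> Fa (mu M Z \<odot> TA M g \<odot> f) =
      mu M (Fo Z) \<odot> TA M (d Z \<odot> Fa g) \<odot> d Y \<odot> Fa f"
    if "f \<in> hom M X (TO M Y)" "g \<in> hom M Y (TO M Z)" "Z \<in> Obj M" for f g X Y Z
  proof -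
    note [simp] = that(1,2)[unfolded hom_def, simplified] that(3)
    have [simp]: "Y \<in> Obj M" using that(2) hom_Obj by blast
    have "d Z \<odot> Fa (mu M Z \<odot> TA M g \<odot> f) = d Z \<odot> Fa (mu M Z) \<odot> Fa (TA M g) \<odot> Fa f"
      by (simp add: F.map_Comp)
    also have "\<dots> = mu M (Fo Z) \<odot> TA M (d Z) \<odot> d (TO M Z) \<odot> Fa (TA M g) \<odot> Fa f"
      by (simp add: Comp_reassoc[OF distributive_lawD(6)[OF d]])
    also have "\<dots> = mu M (Fo Z) \<odot> TA M (d Z) \<odot> TA M (Fa g) \<odot> d Y \<odot> Fa f"
      using Comp_reassoc[OF distributive_lawD(4)[OF d, of g], of "Fa f"] by simp
    finally show ?thesis by (simp add: T.map_Comp)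
  qed
  show ?thesis
    unfolding is_functor_def
  proof (intro conjI allI ballI)
    fix X Y Z f g
    assume f: "f \<in> hom (Kl M) X Y" and g: "g \<in> hom (Kl M) Y Z"
    then show "lift Fo (\<lambda>X p. d X \<odot> Fa p) (g \<odot>\<^bsub>Kl M\<^esub> f) =
      lift Fo (\<lambda>X p. d X \<odot> Fa p) g \<odot>\<^bsub>Kl M\<^esub> lift Fo (\<lambda>X p. d X \<odot> Fa p) f"
      using comp[of "fst f" X Y "fst g" Z]
      by (auto simp: Kl_hom khom_def Kl_sel lift_def kcomp_def split: if_splits)
  qed (auto simp: Kl_sel hom_def lift_def distributive_lawD(5)[OF d])
qed

sublocale KlSig: endofunctor "Kl M" "SigO M" "lift (SigO M) (SigBar M)"
  using lift_functor[OF Sig dSig] by unfold_locales (simp add: SigBar_def[abs_def])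

sublocale KlB: endofunctor "Kl M" "BO M" "lift (BO M) (BBar M)"
  using lift_functor[OF B dB] by unfold_locales (simp add: BBar_def[abs_def])

lemma JK_hom: "f \<in> hom M X Y \<Longrightarrow> JK M f \<in> hom (Kl M) X Y"
  by (auto simp: Kl_sel hom_def JK_def J_def)

lemma JK_Arr [simp]:
  assumes "f \<in> Arr M"
  shows "JK M f \<in> Arr (Kl M)" "Dom (Kl M) (JK M f) = Dom M f" "Cod (Kl M) (JK M f) = Cod M f"
  using assms by (auto simp: Kl_sel JK_def J_def)

text \<open>\<open>mu\<close> cancels against the \<open>eta\<close> inside \<open>J\<close>. This
  is what finally turns a Kleisli equation back into one about
  \<open>tr \<odot> iota\<close>.\<close>

lemma Comp_JK:
  assumes "p \<in> Arr (Kl M)" "f \<in> Arr M" "Dom M (fst p) = Cod M f"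
  shows "p \<odot>\<^bsub>Kl M\<^esub> JK M f = (fst p \<odot> f, snd p)"
  using assms by (simp add: Kl_sel JK_def J_def kcomp_def eta_natural)

lemma JK_Comp:
  assumes "f \<in> Arr M" "g \<in> Arr M" "Dom M g = Cod M f"
  shows "JK M g \<odot>\<^bsub>Kl M\<^esub> JK M f = JK M (g \<odot> f)"
  using assms by (subst Comp_JK) (auto simp: JK_def J_def Kl_sel)

lemma JK_Id: "X \<in> Obj M \<Longrightarrow> JK M (Id M X) = Id (Kl M) X"
  by (simp add: JK_def J_def Kl_sel)

lemma SigBar_JK:
  assumes "f \<in> Arr M"
  shows "lift (SigO M) (SigBar M) (JK M f) = JK M (SigA M f)"
  using assms distributive_lawD(1-3)[OF dSig, of "Cod M f"]
    Comp_reassoc[OF distributive_lawD(5)[OF dSig, of "Cod M f"], of "SigA M f"]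
  by (simp add: lift_def JK_def J_def SigBar_def Sig.map_Comp)

lemma muB_facts [simp]: "muB M \<in> Obj M" "beta M \<in> Arr M" "Dom M (beta M) = BO M (muB M)"
    "Cod M (beta M) = muB M"
  using muB by (auto simp: initial_algebra_def hom_def)

text \<open>A Kleisli algebra \<open>a\<close> on \<open>A\<close> induces the base algebra
  \<open>mu \<odot> TA a \<odot> dB\<close> on \<open>TO A\<close>, and Kleisli algebra morphisms
  from \<open>muB\<close> to \<open>a\<close> are exactly the base algebra morphisms into the
  induced one, so initiality is inherited.\<close>

lemma Kl_initial_algebra:
  "initial_algebra (Kl M) (BO M) (lift (BO M) (BBar M)) (muB M) (JK M (beta M))"
  unfolding initial_algebra_def
proof (intro conjI ballI)
  show "muB M \<in> Obj (Kl M)" by simp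
  show "JK M (beta M) \<in> hom (Kl M) (BO M (muB M)) (muB M)" by (simp add: hom_def)
  fix A a assume A: "A \<in> Obj (Kl M)" and a: "a \<in> hom (Kl M) (BO M A) A"
  note [simp] = distributive_lawD(1-3)[OF dB]
  let ?a = "mu M A \<odot> TA M (fst a) \<odot> dB M A"
  have [simp]: "A \<in> Obj M" using A by simp
  have [simp]: "fst a \<in> Arr M" "Dom M (fst a) = BO M A" "Cod M (fst a) = TO M A" "snd a = A"
    using a by (auto simp: Kl_sel hom_def)
  have "?a \<in> hom M (BO M (TO M A)) (TO M A)" by (simp add: hom_def)
  then have ex1: "\<exists>!h. h \<in> hom M (muB M) (TO M A) \<and> h \<odot> beta M = ?a \<odot> BA M h"
    using muB by (simp add: initial_algebra_def)
  have iff: "p \<in> hom (Kl M) (muB M) A \<and> p \<odot>\<^bsub>Kl M\<^esub> JK M (beta M) = a \<odot>\<^bsub>Kl M\<^esub> lift (BO M) (BBar M) p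
    \<longleftrightarrow> (\<exists>h. p = (h, A) \<and> h \<in> hom M (muB M) (TO M A) \<and> h \<odot> beta M = ?a \<odot> BA M h)" for p
  proof -
    have "h \<odot> beta M = mu M A \<odot> TA M (fst a) \<odot> dB M A \<odot> BA M h \<longleftrightarrow> h \<odot> beta M = ?a \<odot> BA M h"
      if "h \<in> hom M (muB M) (TO M A)" for h
      using that by (simp add: hom_def)
    then show ?thesis
      by (cases p) (auto simp: Kl_sel hom_def JK_def J_def kcomp_def lift_def BBar_def eta_natural)
  qed
  show "\<exists>!p. p \<in> hom (Kl M) (muB M) A \<and> p \<odot>\<^bsub>Kl M\<^esub> JK M (beta M) = a \<odot>\<^bsub>Kl M\<^esub> lift (BO M) (BBar M) p"
    unfolding iff using ex1 by blast
qed

end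

text \<open>Lambek's lemma. Uniqueness of the inverse is checked as well, so that the definite
  description in \<open>inverse_arr\<close> denotes it.\<close>

lemma (in endofunctor) lambek:
  assumes "initial_algebra C Fo Fa I i"
  shows "is_inverse C i (inverse_arr C i)"
proof -
  have i: "I \<in> Obj C" "i \<in> hom C (Fo I) I" using assms by (auto simp: initial_algebra_def)
  note [simp] = i(1) i(2)[unfolded hom_def, simplified]
  have "Fa i \<in> hom C (Fo (Fo I)) (Fo I)" by (simp add: hom_def)
  then obtain h where h: "h \<in> hom C I (Fo I)" "h \<odot> i = Fa i \<odot> Fa h"
    using assms unfolding initial_algebra_def by (metis Obj_map i(1))
  note [simp] = h(1)[unfolded hom_def, simplified]
  have "\<exists>!k. k \<in> hom C I I \<and> k \<odot> i = i \<odot> Fa k"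
    using assms by (simp add: initial_algebra_def)
  moreover have "(i \<odot> h) \<odot> i = i \<odot> Fa (i \<odot> h)" by (simp add: h(2) map_Comp)
  moreover have "i \<odot> h \<in> hom C I I" by (simp add: hom_def)
  moreover have "Id C I \<in> hom C I I \<and> Id C I \<odot> i = i \<odot> Fa (Id C I)" by (simp add: hom_def)
  ultimately have ih: "i \<odot> h = Id C I" by blast
  have hi: "h \<odot> i = Id C (Fo I)" using ih by (simp add: h(2) map_Comp[symmetric])
  have inv: "is_inverse C i h" using ih hi by (simp add: is_inverse_def hom_def)
  moreover have "k = h" if "is_inverse C i k" for k
  proof -
    have k: "k \<in> Arr C" "Dom C k = I" "Cod C k = Fo I" "k \<odot> i = Id C (Fo I)"
      using that by (auto simp: is_inverse_def hom_def)
    have "k = k \<odot> i \<odot> h" using k(1-3) by (simp add: ih)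
    also have "\<dots> = h" using k(1-3) by (simp add: Comp_reassoc[OF k(4)])
    finally show ?thesis .
  qed
  ultimately show ?thesis unfolding inverse_arr_def by (rule theI)
qed

section \<open>Transport of order structure along an injection\<close>

lemma is_lub_on_image:
  assumes "s \<in> A"
  shows "is_lub_on (\<phi> ` A) le (\<phi> ` D) (\<phi> s) \<longleftrightarrow> is_lub_on A (\<lambda>x y. le (\<phi> x) (\<phi> y)) D s"
  using assms by (auto simp: is_lub_on_def)

lemma is_least_on_image:
  assumes "s \<in> A"
  shows "is_least_on (\<phi> ` A) le (\<phi> s) \<longleftrightarrow> is_least_on A (\<lambda>x y. le (\<phi> x) (\<phi> y)) s"
  using assms by (auto simp: is_least_on_def)

lemma directed_in_image:
  "directed_in A (\<lambda>x y. le (\<phi> x) (\<phi> y)) D \<Longrightarrow> directed_in (\<phi> ` A) le (\<phi> ` D)"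
  unfolding directed_in_def by blast

text \<open>Meant for \<open>fst\<close>: the order lives on base arrows, whereas arrows of
  \<open>Kl\<close> carry a codomain tag. Injectivity preserves antisymmetry.\<close>

lemma pointed_dcpo_on_inj_image:
  assumes "inj_on \<phi> A" "pointed_dcpo_on (\<phi> ` A) le"
  shows "pointed_dcpo_on A (\<lambda>x y. le (\<phi> x) (\<phi> y))"
  unfolding pointed_dcpo_on_def
proof (intro conjI allI impI)
  show "reflp_on A (\<lambda>x y. le (\<phi> x) (\<phi> y))" "transp_on A (\<lambda>x y. le (\<phi> x) (\<phi> y))"
    using assms(2) unfolding pointed_dcpo_on_def reflp_on_def transp_on_def by blast+
  show "antisymp_on A (\<lambda>x y. le (\<phi> x) (\<phi> y))"
    using assms unfolding pointed_dcpo_on_def antisymp_on_def inj_on_def by blast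
  show "\<exists>s. is_lub_on A (\<lambda>x y. le (\<phi> x) (\<phi> y)) D s"
    if D: "directed_in A (\<lambda>x y. le (\<phi> x) (\<phi> y)) D" for D
  proof -
    obtain u where u: "is_lub_on (\<phi> ` A) le (\<phi> ` D) u"
      using assms(2) directed_in_image[where \<phi>=\<phi> and le=le, OF D] unfolding pointed_dcpo_on_def by blast
    then obtain s where "s \<in> A" "u = \<phi> s" by (auto simp: is_lub_on_def)
    then show ?thesis using u is_lub_on_image[of s A \<phi> le D] by blast
  qed
  show "\<exists>b. is_least_on A (\<lambda>x y. le (\<phi> x) (\<phi> y)) b"
    using assms(2) unfolding pointed_dcpo_on_def is_least_on_def by blast
qed

context de_simone_setting
begin

abbreviation kl_le where "kl_le X Y p q \<equiv> kle M X Y (fst p) (fst q)"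

lemma khom_image: "khom M X Y = fst ` hom (Kl M) X Y"
proof (intro set_eqI iffI)
  show "f \<in> fst ` hom (Kl M) X Y" if "f \<in> khom M X Y" for f
    using that by (intro image_eqI[of _ _ "(f, Y)"]) (simp_all add: Kl_hom)
qed (auto simp: Kl_hom)

sublocale Kl: dcpo_enriched "Kl M" kl_le
proof
  fix X Y assume "X \<in> Obj (Kl M)" "Y \<in> Obj (Kl M)"
  then show "pointed_dcpo_on (hom (Kl M) X Y) (kl_le X Y)"
    using kle_dcpo[of X Y] by (intro pointed_dcpo_on_inj_image[where \<phi>=fst and le="kle M X Y"])
      (auto simp: khom_image[symmetric] inj_on_def Kl_hom prod_eq_iff)
next
  fix X Y Z g D s
  assume a: "X \<in> Obj (Kl M)" "Y \<in> Obj (Kl M)" "Z \<in> Obj (Kl M)" "g \<in> hom (Kl M) Y Z"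
    and D: "directed_in (hom (Kl M) X Y) (kl_le X Y) D" "is_lub_on (hom (Kl M) X Y) (kl_le X Y) D s"
  have s: "s \<in> hom (Kl M) X Y" using D(2) by (simp add: is_lub_on_def)
  have "is_lub_on (khom M X Z) (kle M X Z) (kcomp M Z (fst g) ` fst ` D) (kcomp M Z (fst g) (fst s))"
    using a directed_in_image[where \<phi>=fst and le="kle M X Y", OF D(1)] D(2)[folded is_lub_on_image[where \<phi>=fst and le="kle M X Y", OF s]]
    by (intro kcomp_join_right[of X Y Z]) (simp_all add: khom_image[symmetric] Kl_hom)
  moreover have "kcomp M Z (fst g) ` fst ` D = fst ` (\<lambda>f. g \<odot>\<^bsub>Kl M\<^esub> f) ` D"
    "kcomp M Z (fst g) (fst s) = fst (g \<odot>\<^bsub>Kl M\<^esub> s)"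
    using a(4) by (auto simp: image_image Kl_sel Kl_hom)
  ultimately show "is_lub_on (hom (Kl M) X Z) (kl_le X Z) ((\<lambda>f. g \<odot>\<^bsub>Kl M\<^esub> f) ` D) (g \<odot>\<^bsub>Kl M\<^esub> s)"
    using is_lub_on_image[where \<phi>=fst and le="kle M X Z", OF Kl.Comp_hom[OF s a(4)]] by (simp add: khom_image)
next
  fix X Y Z f D s
  assume a: "X \<in> Obj (Kl M)" "Y \<in> Obj (Kl M)" "Z \<in> Obj (Kl M)" "f \<in> hom (Kl M) X Y"
    and D: "directed_in (hom (Kl M) Y Z) (kl_le Y Z) D" "is_lub_on (hom (Kl M) Y Z) (kl_le Y Z) D s"
  have s: "s \<in> hom (Kl M) Y Z" using D(2) by (simp add: is_lub_on_def)
  have "is_lub_on (khom M X Z) (kle M X Z) ((\<lambda>g. kcomp M Z g (fst f)) ` fst ` D)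
      (kcomp M Z (fst s) (fst f))"
    using a directed_in_image[where \<phi>=fst and le="kle M Y Z", OF D(1)] D(2)[folded is_lub_on_image[where \<phi>=fst and le="kle M Y Z", OF s]]
    by (intro kcomp_join_left[of X Y Z]) (simp_all add: khom_image[symmetric] Kl_hom)
  \<comment> \<open>The varying factor now supplies the codomain tag of the composite, so
    \<open>D\<close> has to be known to lie in the hom-set.\<close>
  moreover have "(\<lambda>g. kcomp M Z g (fst f)) ` fst ` D = fst ` (\<lambda>g. g \<odot>\<^bsub>Kl M\<^esub> f) ` D"
    using D(1) by (force simp: image_image Kl_sel Kl_hom directed_in_def subset_iff intro!: image_cong)
  moreover have "kcomp M Z (fst s) (fst f) = fst (s \<odot>\<^bsub>Kl M\<^esub> f)"
    using s by (auto simp: Kl_sel Kl_hom)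
  ultimately show "is_lub_on (hom (Kl M) X Z) (kl_le X Z) ((\<lambda>g. g \<odot>\<^bsub>Kl M\<^esub> f) ` D) (s \<odot>\<^bsub>Kl M\<^esub> f)"
    using is_lub_on_image[where \<phi>=fst and le="kle M X Z", OF Kl.Comp_hom[OF a(4) s]] by (simp add: khom_image)
next
  fix X Y Z f b
  assume a: "X \<in> Obj (Kl M)" "Y \<in> Obj (Kl M)" "Z \<in> Obj (Kl M)" "f \<in> hom (Kl M) X Y"
    and b: "is_least_on (hom (Kl M) Y Z) (kl_le Y Z) b"
  have b': "b \<in> hom (Kl M) Y Z" using b by (simp add: is_least_on_def)
  have "is_least_on (khom M X Z) (kle M X Z) (kcomp M Z (fst b) (fst f))"
    using a b[folded is_least_on_image[where \<phi>=fst and le="kle M Y Z", OF b']]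
    by (intro kcomp_bot[of X Y Z]) (simp_all add: khom_image[symmetric] Kl_hom)
  moreover have "kcomp M Z (fst b) (fst f) = fst (b \<odot>\<^bsub>Kl M\<^esub> f)"
    using b' by (auto simp: Kl_sel Kl_hom)
  ultimately show "is_least_on (hom (Kl M) X Z) (kl_le X Z) (b \<odot>\<^bsub>Kl M\<^esub> f)"
    using is_least_on_image[where \<phi>=fst and le="kle M X Z", OF Kl.Comp_hom[OF a(4) b']] by (simp add: khom_image)
qed

theorem Kl_final_coalgebra:
  "final_coalgebra (Kl M) (BO M) (lift (BO M) (BBar M)) (muB M) (JK M (inverse_arr M (beta M)))"
proof (rule Kl.initial_algebra_final_coalgebra[OF KlB.is_functor _ Kl_initial_algebra])
  fix X Y f g
  assume "f \<in> hom (Kl M) X Y" "g \<in> hom (Kl M) X Y" "kl_le X Y f g"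
  then show "kl_le (BO M X) (BO M Y) (lift (BO M) (BBar M) f) (lift (BO M) (BBar M) g)"
    using BBar_mono[of X Y "fst f" "fst g"] Kl.hom_Obj[of f X Y] by (simp add: lift_def Kl_hom)
next
  have "is_inverse M (beta M) (inverse_arr M (beta M))" by (rule B.lambek[OF muB])
  then show "is_inverse (Kl M) (JK M (beta M)) (JK M (inverse_arr M (beta M)))"
    unfolding is_inverse_def by (auto simp: JK_hom JK_Comp hom_def JK_Id)
qed

end

section \<open>Affine morphisms and De Simone laws\<close>

context de_simone_setting
begin

section \<open>Functoriality of the free monad\<close>

lemma StarA:
  assumes "f \<in> Arr M"
  shows "StarA M f \<in> hom M (StarO M (Dom M f)) (StarO M (Cod M f))"
    "StarA M f \<odot> star_op M (Dom M f) = star_op M (Cod M f) \<odot> SigA M (StarA M f)"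
    "StarA M f \<odot> star_unit M (Dom M f) = star_unit M (Cod M f) \<odot> f"
proof -
  have "star_op M (Cod M f) \<in> hom M (SigO M (StarO M (Cod M f))) (StarO M (Cod M f))"
    "star_unit M (Cod M f) \<odot> f \<in> hom M (Dom M f) (StarO M (Cod M f))"
    using assms by (simp_all add: hom_def)
  from theI'[OF F.free_ex1[OF this]] assms
  show "StarA M f \<in> hom M (StarO M (Dom M f)) (StarO M (Cod M f))"
    "StarA M f \<odot> star_op M (Dom M f) = star_op M (Cod M f) \<odot> SigA M (StarA M f)"
    "StarA M f \<odot> star_unit M (Dom M f) = star_unit M (Cod M f) \<odot> f"
    by (simp_all add: StarA_def star_ext_def)
qed

lemma StarA_eqI:
  assumes "f \<in> Arr M" "h \<in> hom M (StarO M (Dom M f)) (StarO M (Cod M f))"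
    "h \<odot> star_op M (Dom M f) = star_op M (Cod M f) \<odot> SigA M h"
    "h \<odot> star_unit M (Dom M f) = star_unit M (Cod M f) \<odot> f"
  shows "StarA M f = h"
  by (rule F.free_eq[of "star_op M (Cod M f)" "StarO M (Cod M f)" "Dom M f"])
    (use assms StarA[OF assms(1)] in \<open>simp_all add: hom_def\<close>)

sublocale StarF: endofunctor M "StarO M" "StarA M"
proof
  show "is_functor M M (StarO M) (StarA M)"
    unfolding is_functor_def
  proof (intro conjI allI ballI)
    fix X Y Z f g assume "f \<in> hom M X Y" "g \<in> hom M Y Z"
    then have a: "f \<in> Arr M" "g \<in> Arr M" "Dom M f = X" "Cod M f = Y" "Dom M g = Y" "Cod M g = Z"
      by (auto simp: hom_def)
    have [simp]: "X \<in> Obj M" "Y \<in> Obj M" "Z \<in> Obj M" using a by auto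
    note f = StarA[OF a(1), unfolded a] and g = StarA[OF a(2), unfolded a]
    note [simp] = a f(1)[unfolded hom_def, simplified] g(1)[unfolded hom_def, simplified]
    show "StarA M (g \<odot> f) = StarA M g \<odot> StarA M f"
    proof (rule StarA_eqI)
      show "(StarA M g \<odot> StarA M f) \<odot> star_op M (Dom M (g \<odot> f)) =
        star_op M (Cod M (g \<odot> f)) \<odot> SigA M (StarA M g \<odot> StarA M f)"
        by (simp add: f(2) Comp_reassoc[OF g(2)] Sig.map_Comp)
      show "(StarA M g \<odot> StarA M f) \<odot> star_unit M (Dom M (g \<odot> f)) =
        star_unit M (Cod M (g \<odot> f)) \<odot> g \<odot> f"
        by (simp add: f(3) Comp_reassoc[OF g(3)])
    qed (simp_all add: hom_def)
  next
    fix X assume "X \<in> Obj M"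
    then show "StarA M (Id M X) = Id M (StarO M X)"
      by (intro StarA_eqI) (simp_all add: hom_def)
  next
    fix X Y f assume "f \<in> hom M X Y"
    then show "StarA M f \<in> hom M (StarO M X) (StarO M Y)"
      using StarA(1)[of f] by (auto simp: hom_def)
  qed simp
qed

section \<open>Affine morphisms\<close>

lemma bang [simp]:
  assumes "X \<in> Obj M"
  shows "bang M X \<in> Arr M" "Dom M (bang M X) = X" "Cod M (bang M X) = One M"
proof -
  have "\<exists>!h. h \<in> hom M X (One M)" using One assms by (simp add: is_terminal_def)
  from theI'[OF this] show "bang M X \<in> Arr M" "Dom M (bang M X) = X" "Cod M (bang M X) = One M"
    by (simp_all add: bang_def hom_def)
qed

lemma One_Obj [simp]: "One M \<in> Obj M"
  using One by (simp add: is_terminal_def)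

lemma bang_eq:
  assumes "f \<in> Arr M" "Cod M f = One M" "Dom M f = X"
  shows "f = bang M X"
proof -
  have X: "X \<in> Obj M" using assms by auto
  have "\<exists>!h. h \<in> hom M X (One M)" using One X by (simp add: is_terminal_def)
  moreover have "f \<in> hom M X (One M)" "bang M X \<in> hom M X (One M)"
    using assms X by (simp_all add: hom_def)
  ultimately show ?thesis by blast
qed

lemma aff_Arr [simp]:
  assumes "X \<in> Obj M"
  shows "TplusO M X \<in> Obj M" "aff M X \<in> Arr M" "Dom M (aff M X) = TplusO M X" "Cod M (aff M X) = TO M X"
  using aff[OF assms] by (auto simp: is_equalizer_def hom_def)

text \<open>The universal property of the equalizer, with \<open>bang M (TO M X) \<odot> p\<close>
  collapsed by terminality. The equational form is what the preservation lemmas compute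
  with.\<close>

lemma affine_iff:
  assumes "p \<in> hom M P (TO M X)" "X \<in> Obj M"
  shows "affine M P X p \<longleftrightarrow> TA M (bang M X) \<odot> p = eta M (One M) \<odot> bang M P"
proof -
  have P: "P \<in> Obj M" using assms hom_Obj by blast
  note [simp] = assms(2) P assms(1)[unfolded hom_def, simplified]
  have "bang M (TO M X) \<odot> p = bang M P" by (rule bang_eq) simp_all
  moreover have "bang M (TO M X) \<odot> aff M X = bang M (TplusO M X)" by (rule bang_eq) simp_all
  ultimately have eq: "(eta M (One M) \<odot> bang M (TO M X)) \<odot> p = eta M (One M) \<odot> bang M P"
    "(eta M (One M) \<odot> bang M (TO M X)) \<odot> aff M X = eta M (One M) \<odot> bang M (TplusO M X)"
    by simp_all
  have e: "TA M (bang M X) \<odot> aff M X = eta M (One M) \<odot> bang M (TplusO M X)"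
    using aff[of X] eq(2) by (simp add: is_equalizer_def)
  show ?thesis
  proof
    assume "affine M P X p"
    then obtain q where q: "q \<in> hom M P (TplusO M X)" "p = aff M X \<odot> q"
      unfolding affine_def by blast
    note [simp] = q(1)[unfolded hom_def, simplified]
    have "bang M (TplusO M X) \<odot> q = bang M P" by (rule bang_eq) simp_all
    then show "TA M (bang M X) \<odot> p = eta M (One M) \<odot> bang M P"
      unfolding q(2) by (simp add: Comp_reassoc[OF e])
  next
    assume "TA M (bang M X) \<odot> p = eta M (One M) \<odot> bang M P"
    then have "(eta M (One M) \<odot> bang M (TO M X)) \<odot> p = TA M (bang M X) \<odot> p"
      using eq(1) by simp
    then have "\<exists>!k. k \<in> hom M P (TplusO M X) \<and> aff M X \<odot> k = p"
      using aff[of X] assms(1) P unfolding is_equalizer_def by simp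
    then show "affine M P X p" unfolding affine_def by blast
  qed
qed

lemma affine_J:
  assumes "f \<in> hom M P X"
  shows "affine M P X (J M f)"
proof -
  have [simp]: "P \<in> Obj M" "X \<in> Obj M" using assms hom_Obj by blast+
  note [simp] = assms[unfolded hom_def, simplified]
  have "bang M X \<odot> f = bang M P" by (rule bang_eq) simp_all
  then show ?thesis
    by (subst affine_iff) (simp_all add: hom_def J_def eta_natural)
qed

text \<open>The map from \<open>StarO M X\<close> to the terminal object is routed through
  \<open>StarO M (One M)\<close>. Naturality of \<open>dStar\<close> then moves
  \<open>TA M (bang M X)\<close> next to \<open>p\<close>, affineness replaces the composite by one
  through \<open>eta\<close>, and the unit law of \<open>dStar\<close> removes
  \<open>dStar\<close>.\<close>

lemma affine_StarBar:
  assumes "p \<in> hom M P (TO M X)" "X \<in> Obj M" "affine M P X p"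
  shows "affine M (StarO M P) (StarO M X) (StarBar M X p)"
proof -
  have P: "P \<in> Obj M" using assms hom_Obj by blast
  note [simp] = assms(2) P assms(1)[unfolded hom_def, simplified] distributive_lawD(1-3)[OF dStar]
  have p: "TA M (bang M X) \<odot> p = eta M (One M) \<odot> bang M P" using assms affine_iff by blast
  have b: "bang M (StarO M (One M)) \<odot> StarA M (bang M X) = bang M (StarO M X)"
    "bang M (StarO M (One M)) \<odot> StarA M (bang M P) = bang M (StarO M P)"
    by (rule bang_eq; simp)+
  have "TA M (bang M (StarO M X)) \<odot> StarBar M X p =
      TA M (bang M (StarO M (One M))) \<odot> TA M (StarA M (bang M X)) \<odot> dStar M X \<odot> StarA M p"
    by (simp add: StarBar_def b(1)[symmetric] T.map_Comp)
  also have "\<dots> = TA M (bang M (StarO M (One M))) \<odot> dStar M (One M) \<odot> StarA M (TA M (bang M X) \<odot> p)"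
    using Comp_reassoc[OF distributive_lawD(4)[OF dStar, of "bang M X", symmetric], of "StarA M p"]
    by (simp add: StarF.map_Comp)
  also have "\<dots> = TA M (bang M (StarO M (One M))) \<odot> eta M (StarO M (One M)) \<odot> StarA M (bang M P)"
    by (simp add: p StarF.map_Comp Comp_reassoc[OF distributive_lawD(5)[OF dStar]])
  also have "\<dots> = eta M (One M) \<odot> bang M (StarO M P)"
    by (simp add: eta_natural b(2))
  finally show ?thesis
    by (subst affine_iff) (simp_all add: hom_def StarBar_def)
qed

section \<open>Coproducts and the action of \<open>B0\<close> on Kleisli morphisms\<close>

lemma inj_Arr [simp]:
  assumes "X \<in> Obj M" "Y \<in> Obj M"
  shows "Cop M X Y \<in> Obj M" "inl M X Y \<in> Arr M" "Dom M (inl M X Y) = X" "Cod M (inl M X Y) = Cop M X Y"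
    "inr M X Y \<in> Arr M" "Dom M (inr M X Y) = Y" "Cod M (inr M X Y) = Cop M X Y"
  using Cop[OF assms] by (auto simp: is_coproduct_def hom_def)

lemma copair_ex1:
  assumes "f \<in> Arr M" "g \<in> Arr M" "Cod M f = Cod M g"
  shows "\<exists>!h. h \<in> hom M (Cop M (Dom M f) (Dom M g)) (Cod M f) \<and>
     h \<odot> inl M (Dom M f) (Dom M g) = f \<and> h \<odot> inr M (Dom M f) (Dom M g) = g"
  using Cop[of "Dom M f" "Dom M g"] assms
  unfolding is_coproduct_def hom_def by (simp (no_asm_use) add: hom_def) auto

lemma copair [simp]:
  assumes "f \<in> Arr M" "g \<in> Arr M" "Cod M f = Cod M g"
  shows "copair M f g \<in> Arr M" "Dom M (copair M f g) = Cop M (Dom M f) (Dom M g)"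
    "Cod M (copair M f g) = Cod M g"
    and copair_inl: "\<And>X Y. \<lbrakk>Dom M f = X; Dom M g = Y\<rbrakk> \<Longrightarrow> copair M f g \<odot> inl M X Y = f"
    and copair_inr: "\<And>X Y. \<lbrakk>Dom M f = X; Dom M g = Y\<rbrakk> \<Longrightarrow> copair M f g \<odot> inr M X Y = g"
  using theI'[OF copair_ex1[OF assms]] assms(3)
  unfolding copair_def[symmetric] by (auto simp: hom_def)

lemma copair_eqI:
  assumes "h \<in> Arr M" "Dom M h = Cop M X Y" "X \<in> Obj M" "Y \<in> Obj M"
    and "h \<odot> inl M X Y = f" "h \<odot> inr M X Y = g"
  shows "h = copair M f g"
proof -
  have a: "f \<in> Arr M" "g \<in> Arr M" "Cod M f = Cod M g" "Cod M f = Cod M h"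
    "Dom M f = X" "Dom M g = Y"
    using assms by auto
  let ?P = "\<lambda>h. h \<in> hom M (Cop M X Y) (Cod M f) \<and> h \<odot> inl M X Y = f \<and> h \<odot> inr M X Y = g"
  have "?P h" "?P (copair M f g)" using a assms by (simp_all add: hom_def)
  moreover have "\<exists>!h. ?P h" using copair_ex1[OF a(1-3)] unfolding a(5,6) .
  ultimately show ?thesis by blast
qed

lemma Comp_copair:
  assumes "f \<in> Arr M" "g \<in> Arr M" "Cod M f = Cod M g" "h \<in> Arr M" "Dom M h = Cod M g"
  shows "h \<odot> copair M f g = copair M (h \<odot> f) (h \<odot> g)"
  using assms by (intro copair_eqI[where X="Dom M f" and Y="Dom M g"]) auto

lemma copair_cop_arr:
  assumes "f \<in> Arr M" "g \<in> Arr M" "Cod M f = Cod M g" "h \<in> Arr M" "k \<in> Arr M"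
    "Cod M h = Dom M f" "Cod M k = Dom M g"
  shows "copair M f g \<odot> cop_arr M h k = copair M (f \<odot> h) (g \<odot> k)"
proof -
  have [simp]: "copair M f g \<odot> inl M (Dom M f) (Dom M g) \<odot> h = f \<odot> h"
    "copair M f g \<odot> inr M (Dom M f) (Dom M g) \<odot> k = g \<odot> k"
    using assms by (simp_all add: Comp_reassoc[OF copair_inl] Comp_reassoc[OF copair_inr])
  show ?thesis using assms by (simp add: cop_arr_def Comp_copair)
qed

lemma cop_arr_Arr [simp]:
  assumes "f \<in> Arr M" "g \<in> Arr M"
  shows "cop_arr M f g \<in> Arr M" "Dom M (cop_arr M f g) = Cop M (Dom M f) (Dom M g)"
    "Cod M (cop_arr M f g) = Cop M (Cod M f) (Cod M g)"
  using assms by (simp_all add: cop_arr_def)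

text \<open>The componentwise form is the one to which naturality of \<open>jay\<close>
  applies.\<close>

lemma B0Bar_kcop_arr:
  assumes "p \<in> hom M P (TO M X)" "X \<in> Obj M"
  shows "B0Bar M X p = kcop_arr M X (BO M X) p (BBar M X p)"
proof -
  have P: "P \<in> Obj M" using assms hom_Obj by blast
  note [simp] = assms(2) P assms(1)[unfolded hom_def, simplified] distributive_lawD(1-3)[OF dB]
  show ?thesis
    by (simp add: B0Bar_def dB0_def B0A_def kcop_arr_def BBar_def copair_cop_arr)
qed

lemma kcop_arr_Arr [simp]:
  assumes "f \<in> Arr M" "g \<in> Arr M" "Cod M f = TO M X" "Cod M g = TO M Y" "X \<in> Obj M" "Y \<in> Obj M"
  shows "kcop_arr M X Y f g \<in> Arr M" "Dom M (kcop_arr M X Y f g) = Cop M (Dom M f) (Dom M g)"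
    "Cod M (kcop_arr M X Y f g) = TO M (Cop M X Y)"
  using assms by (simp_all add: kcop_arr_def)

text \<open>An affine \<open>p\<close> is \<open>aff\<close> precomposed with a base morphism
  \<open>q\<close>, so the naturality square at \<open>aff\<close> is pasted with the ordinary one
  at \<open>q\<close>.\<close>

lemma natural_wrt_affine:
  assumes \<rho>: "de_simone_law M \<rho>" and p: "affine M P X p" "X \<in> Obj M"
  shows "natural_wrt M \<rho> P X p"
proof -
  obtain q where q: "q \<in> hom M P (TplusO M X)" "p = aff M X \<odot> q"
    using p(1) unfolding affine_def by blast
  have P: "P \<in> Obj M" using q(1) hom_Obj by blast
  note [simp] = p(2) P q(1)[unfolded hom_def, simplified] distributive_lawD(1-3)[OF dB]
    distributive_lawD(1-3)[OF dSig] distributive_lawD(1-3)[OF dStar]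
  have [simp]: "\<rho> Y \<in> Arr M" "Dom M (\<rho> Y) = SigO M (Cop M Y (BO M Y))" "Cod M (\<rho> Y) = TO M (BO M (StarO M Y))"
    if "Y \<in> Obj M" for Y
    using \<rho> that by (auto simp: de_simone_law_def pre_de_simone_law_def hom_def B0O_def)
  let ?i = "aff M X" and ?T = "TplusO M X" and ?B = "BO M X" and ?F = "StarO M X"
  have nat: "\<rho> ?T \<odot> SigA M (B0A M q) = TA M (BA M (StarA M q)) \<odot> \<rho> P"
    using \<rho> q(1) by (simp add: de_simone_law_def pre_de_simone_law_def)
  have i: "kcomp M (BO M ?F) (\<rho> X) (SigBar M (B0O M X) (B0Bar M X ?i)) =
      kcomp M (BO M ?F) (BBar M ?F (StarBar M X ?i)) (\<rho> ?T)"
    using \<rho> by (simp add: de_simone_law_def natural_wrt_def)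
  have Bar_Arr [simp]: "B0Bar M X ?i \<in> Arr M" "Dom M (B0Bar M X ?i) = Cop M ?T (BO M ?T)"
    "Cod M (B0Bar M X ?i) = TO M (Cop M X (BO M X))"
    by (simp_all add: B0Bar_kcop_arr[of _ ?T] hom_def BBar_def)
  have [simp]: "B0A M q \<in> Arr M" "Dom M (B0A M q) = Cop M P (BO M P)" "Cod M (B0A M q) = Cop M ?T (BO M ?T)"
    by (simp_all add: B0A_def)
  \<comment> \<open>A Kleisli extension turns precomposition with a base morphism into
    precomposition with its functor image, which splits off \<open>q\<close>.\<close>
  have "B0Bar M X p = B0Bar M X ?i \<odot> B0A M q"
    unfolding q(2)
    by (simp add: B0Bar_kcop_arr[of _ ?T] B0Bar_kcop_arr[of _ P] hom_def BBar_def kcop_arr_def B0A_def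
        copair_cop_arr B.map_Comp)
  then have "kcomp M (BO M ?F) (\<rho> X) (SigBar M (B0O M X) (B0Bar M X p)) =
      kcomp M (BO M ?F) (\<rho> X) (SigBar M (B0O M X) (B0Bar M X ?i)) \<odot> SigA M (B0A M q)"
    by (simp add: kcomp_def SigBar_def B0O_def Sig.map_Comp)
  also have "\<dots> = mu M (BO M ?F) \<odot> TA M (BBar M ?F (StarBar M X ?i)) \<odot> TA M (BA M (StarA M q)) \<odot> \<rho> P"
    unfolding i by (simp add: kcomp_def BBar_def StarBar_def nat)
  also have "\<dots> = kcomp M (BO M ?F) (BBar M ?F (StarBar M X p)) (\<rho> P)"
    unfolding q(2) by (simp add: kcomp_def BBar_def StarBar_def StarF.map_Comp B.map_Comp T.map_Comp)
  finally show ?thesis by (simp add: natural_wrt_def)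
qed

section \<open>Products and free algebras in the Kleisli category\<close>

definition is_kproj where
  "is_kproj X Y p q \<longleftrightarrow> p \<in> khom M (Cop M X Y) X \<and> q \<in> khom M (Cop M X Y) Y \<and>
     (\<forall>Z \<in> Obj M. \<forall>f \<in> khom M Z X. \<forall>g \<in> khom M Z Y. \<forall>h \<in> khom M Z (Cop M X Y).
        (kcomp M X p h = f \<and> kcomp M Y q h = g) \<longleftrightarrow> h = kpair M X Y f g)"

text \<open>\<open>kleisli_product\<close> provides projections only existentially; choosing them
  makes them operations on objects, as an interpretation of \<open>products\<close>
  requires.\<close>

definition kproj where "kproj X Y = (SOME pq. is_kproj X Y (fst pq) (snd pq))"

lemma kproj:
  assumes "X \<in> Obj M" "Y \<in> Obj M"
  shows "is_kproj X Y (fst (kproj X Y)) (snd (kproj X Y))"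
proof -
  have "\<exists>pq. is_kproj X Y (fst pq) (snd pq)"
    using jay_product[OF assms] unfolding kleisli_product_def is_kproj_def by auto
  then show ?thesis unfolding kproj_def by (rule someI_ex)
qed

lemma kpair_khom:
  assumes "f \<in> khom M Z X" "g \<in> khom M Z Y"
  shows "kpair M X Y f g \<in> khom M Z (Cop M X Y)"
  using assms jay_hom[of X Y] by (auto simp: khom_def kpair_def hom_def pair_tuple split: if_splits)

abbreviation kp1 where "kp1 X Y \<equiv> (fst (kproj X Y), X)"
abbreviation kp2 where "kp2 X Y \<equiv> (snd (kproj X Y), Y)"

sublocale KlP: products "Kl M" "Cop M" kp1 kp2
proof
  fix X Y assume "X \<in> Obj (Kl M)" "Y \<in> Obj (Kl M)"
  then have [simp]: "X \<in> Obj M" "Y \<in> Obj M" by simp_all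
  note k = kproj[OF this, unfolded is_kproj_def]
  show "is_product (Kl M) X Y (Cop M X Y) (kp1 X Y) (kp2 X Y)"
    unfolding is_product_def
  proof (intro conjI ballI)
    fix Z f g assume Z: "Z \<in> Obj (Kl M)" and f: "f \<in> hom (Kl M) Z X" and g: "g \<in> hom (Kl M) Z Y"
    have "h \<in> hom (Kl M) Z (Cop M X Y) \<and> kp1 X Y \<odot>\<^bsub>Kl M\<^esub> h = f \<and> kp2 X Y \<odot>\<^bsub>Kl M\<^esub> h = g \<longleftrightarrow>
      h = (kpair M X Y (fst f) (fst g), Cop M X Y)" for h
    proof -
      have f': "fst f \<in> khom M Z X" "snd f = X" and g': "fst g \<in> khom M Z Y" "snd g = Y" and Z': "Z \<in> Obj M"
        using f g Z by (simp_all add: Kl_hom)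
      have "kcomp M X (fst (kproj X Y)) (fst h) = fst f \<and> kcomp M Y (snd (kproj X Y)) (fst h) = fst g
          \<longleftrightarrow> fst h = kpair M X Y (fst f) (fst g)" if "fst h \<in> khom M Z (Cop M X Y)"
        using k Z' f'(1) g'(1) that by blast
      then show ?thesis
        using kpair_khom[OF f'(1) g'(1)] f'(2) g'(2) by (auto simp: Kl_hom Kl_sel prod_eq_iff)
    qed
    then show "\<exists>!h. h \<in> hom (Kl M) Z (Cop M X Y) \<and> kp1 X Y \<odot>\<^bsub>Kl M\<^esub> h = f \<and> kp2 X Y \<odot>\<^bsub>Kl M\<^esub> h = g"
      by simp
  qed (use k in \<open>auto simp: Kl_hom\<close>)
qed

text \<open>Ties the abstract pairing, defined from the chosen projections, to the concrete one
  through \<open>jay\<close> that occurs in the operational model.\<close>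

lemma Kl_tuple:
  assumes "f \<in> hom (Kl M) Z X" "g \<in> hom (Kl M) Z Y"
  shows "KlP.tuple f g = (kpair M X Y (fst f) (fst g), Cop M X Y)"
proof -
  have O: "X \<in> Obj M" "Y \<in> Obj M" "Z \<in> Obj M"
    using Kl.hom_Obj[OF assms(1)] Kl.hom_Obj[OF assms(2)] by simp_all
  have k: "kpair M X Y (fst f) (fst g) \<in> khom M Z (Cop M X Y)"
    using assms by (intro kpair_khom) (simp_all add: Kl_hom)
  then have "kcomp M X (fst (kproj X Y)) (kpair M X Y (fst f) (fst g)) = fst f"
    "kcomp M Y (snd (kproj X Y)) (kpair M X Y (fst f) (fst g)) = fst g"
    using kproj[OF O(1,2)] assms O(3) unfolding is_kproj_def Kl_hom by blast+
  moreover have "snd f = X" "snd g = Y" using assms by (simp_all add: Kl_hom)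
  ultimately show ?thesis
    using k O by (intro KlP.tuple_eqI[symmetric, of _ X Y])
      (auto simp: Kl_sel khom_def hom_def prod_eq_iff split: if_splits)
qed

sublocale KlF: free_algebras "Kl M" "Cop M" kp1 kp2 "SigO M" "lift (SigO M) (SigBar M)" "StarO M"
  "\<lambda>X. JK M (star_op M X)" "\<lambda>X. JK M (star_unit M X)"
proof
  fix X assume "X \<in> Obj (Kl M)"
  then have X [simp]: "X \<in> Obj M" by simp
  show "free_algebra (Kl M) (SigO M) (lift (SigO M) (SigBar M)) X (StarO M X)
      (JK M (star_op M X)) (JK M (star_unit M X))"
    unfolding free_algebra_def
  proof (intro conjI ballI)
    fix A a f assume A: "A \<in> Obj (Kl M)" "a \<in> hom (Kl M) (SigO M A) A" "f \<in> hom (Kl M) X A"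
    let ?P = "\<lambda>h. h \<in> khom M (StarO M X) A \<and>
          kcomp M A h (J M (star_op M X)) = kcomp M A (fst a) (SigBar M A h) \<and>
          kcomp M A h (J M (star_unit M X)) = fst f"
    have ex1: "\<exists>!h. ?P h" using Star_Kleisli A unfolding kleisli_free_monad_def by (simp add: Kl_hom)
    have "p \<in> hom (Kl M) (StarO M X) A \<and>
        p \<odot>\<^bsub>Kl M\<^esub> JK M (star_op M X) = a \<odot>\<^bsub>Kl M\<^esub> lift (SigO M) (SigBar M) p \<and>
        p \<odot>\<^bsub>Kl M\<^esub> JK M (star_unit M X) = f \<longleftrightarrow> (\<exists>h. p = (h, A) \<and> ?P h)" for p
      using A by (cases p) (auto simp: Kl_hom Kl_sel JK_def lift_def prod_eq_iff)
    then show "\<exists>!p. p \<in> hom (Kl M) (StarO M X) A \<and>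
        p \<odot>\<^bsub>Kl M\<^esub> JK M (star_op M X) = a \<odot>\<^bsub>Kl M\<^esub> lift (SigO M) (SigBar M) p \<and>
        p \<odot>\<^bsub>Kl M\<^esub> JK M (star_unit M X) = f"
      using ex1 by simp blast
  qed (auto simp: hom_def)
qed

lemma Kl_gsos:
  assumes "pre_de_simone_law M \<rho>"
  shows "gsos (Kl M) (Cop M) kp1 kp2 (SigO M) (lift (SigO M) (SigBar M)) (StarO M)
    (\<lambda>X. JK M (star_op M X)) (\<lambda>X. JK M (star_unit M X)) (BO M) (lift (BO M) (BBar M))
    (lift (StarO M) (StarBar M)) (\<lambda>X. (\<rho> X, BO M (StarO M X)))"
proof
  fix f assume f: "f \<in> Arr (Kl M)"
  then have f': "fst f \<in> khom M (Dom M (fst f)) (snd f)" "snd f \<in> Obj M" "Dom M (fst f) \<in> Obj M"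
    by (auto simp: Kl_sel khom_def hom_def)
  show "lift (StarO M) (StarBar M) f \<in> hom (Kl M) (StarO M (Dom (Kl M) f)) (StarO M (Cod (Kl M) f))"
    using f distributive_lawD(1-3)[OF dStar] by (auto simp: Kl_sel hom_def lift_def StarBar_def)
  show "lift (StarO M) (StarBar M) f \<odot>\<^bsub>Kl M\<^esub> JK M (star_op M (Dom (Kl M) f)) =
      JK M (star_op M (Cod (Kl M) f)) \<odot>\<^bsub>Kl M\<^esub> lift (SigO M) (SigBar M) (lift (StarO M) (StarBar M) f)"
    "lift (StarO M) (StarBar M) f \<odot>\<^bsub>Kl M\<^esub> JK M (star_unit M (Dom (Kl M) f)) =
      JK M (star_unit M (Cod (Kl M) f)) \<odot>\<^bsub>Kl M\<^esub> f"
    using Star_Kleisli f' unfolding kleisli_free_monad_def by (auto simp: Kl_sel lift_def JK_def)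
next
  fix X assume "X \<in> Obj (Kl M)"
  then show "(\<rho> X, BO M (StarO M X)) \<in> hom (Kl M) (SigO M (Cop M X (BO M X))) (BO M (StarO M X))"
    using assms by (simp add: pre_de_simone_law_def Kl_hom khom_def B0O_def)
qed

text \<open>Kleisli naturality of \<open>jay\<close> lets \<open>B0Bar M X p\<close>, a coproduct of
  morphisms, act on a pairing as a product of morphisms; its first component then reduces to
  \<open>p\<close> by a unit law. This links \<open>natural_wrt\<close> to the paired form
  \<open>natural_at\<close>.\<close>

lemma B0Bar_kpair:
  assumes p: "p \<in> khom M P X" and c: "c \<in> khom M P (BO M P)"
  shows "kcomp M (B0O M X) (B0Bar M X p) (kpair M P (BO M P) (eta M P) c) =
    kpair M X (BO M X) p (kcomp M (BO M X) (BBar M X p) c)"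
proof -
  have X: "X \<in> Obj M" and p': "p \<in> hom M P (TO M X)" using p by (auto simp: khom_def split: if_splits)
  have P: "P \<in> Obj M" using p' hom_Obj by blast
  have c': "c \<in> hom M P (TO M (BO M P))" using c by (auto simp: khom_def split: if_splits)
  note [simp] = X P p'[unfolded hom_def, simplified] c'[unfolded hom_def, simplified]
    distributive_lawD(1-3)[OF dB]
  have [simp]: "jay M Y Z \<in> Arr M" "Dom M (jay M Y Z) = Prd M (TO M Y) (TO M Z)"
    "Cod M (jay M Y Z) = TO M (Cop M Y Z)" if "Y \<in> Obj M" "Z \<in> Obj M" for Y Z
    using jay_hom[OF that] by (auto simp: hom_def)
  have [simp]: "BBar M X p \<in> Arr M" "Dom M (BBar M X p) = BO M P" "Cod M (BBar M X p) = TO M (BO M X)"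
    by (simp_all add: BBar_def)
  have nat: "(mu M (Cop M X (BO M X)) \<odot> TA M (kcop_arr M X (BO M X) p (BBar M X p))) \<odot> jay M P (BO M P) =
    jay M X (BO M X) \<odot> prod_arr M (mu M X \<odot> TA M p) (mu M (BO M X) \<odot> TA M (BBar M X p))"
    using jay_natural[of P "BO M P" p X "BBar M X p" "BO M X"] by (simp add: khom_def hom_def)
  have "kcomp M (B0O M X) (B0Bar M X p) (kpair M P (BO M P) (eta M P) c) =
     ((mu M (Cop M X (BO M X)) \<odot> TA M (kcop_arr M X (BO M X) p (BBar M X p))) \<odot> jay M P (BO M P))
       \<odot> P.tuple (eta M P) c"
    by (simp add: kcomp_def B0O_def B0Bar_kcop_arr[OF p' X] kpair_def pair_tuple)
  also have "\<dots> = kpair M X (BO M X) p (kcomp M (BO M X) (BBar M X p) c)"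
    unfolding nat
    by (simp add: prod_arr_def pair_tuple P.tuple_Comp kpair_def kcomp_def eta_natural)
  finally show ?thesis .
qed

end

theorem theorem28:
  fixes M :: "('o, 'm) setting"
    and \<rho> :: "'o \<Rightarrow> 'm"
    and \<gamma> tr :: 'm
  assumes "de_simone_setting M"
    and "de_simone_law M \<rho>"
    and "operational_model M \<rho> \<gamma>"
    and "trace_morphism M \<gamma> tr"
    and "affine M (muSig M) (muB M) tr"
  shows "morphic_congruence M (TO M (muB M)) tr"
proof -
  interpret de_simone_setting M by fact
  have pre: "pre_de_simone_law M \<rho>" using assms(2) by (simp add: de_simone_law_def)
  interpret G: gsos "Kl M" "Cop M" kp1 kp2 "SigO M" "lift (SigO M) (SigBar M)" "StarO M"
    "\<lambda>X. JK M (star_op M X)" "\<lambda>X. JK M (star_unit M X)" "BO M" "lift (BO M) (BBar M)"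
    "lift (StarO M) (StarBar M)" "\<lambda>X. (\<rho> X, BO M (StarO M X))"
    by (rule Kl_gsos[OF pre])
  \<comment> \<open>The naturality square at the affine \<open>p\<close> is composed with the
    pairing of the identity and \<open>c\<close>, and \<open>B0Bar_kpair\<close> evaluates the side
    containing \<open>B0Bar\<close>.\<close>
  have nat: "G.natural_at (p, X)" if p: "affine M P X p" "p \<in> khom M P X" for p P X
    unfolding G.natural_at_def
  proof
    have X [simp]: "X \<in> Obj M" and p': "p \<in> hom M P (TO M X)"
      using p(2) by (auto simp: khom_def split: if_splits)
    have P [simp]: "P \<in> Obj M" using p' hom_Obj by blast
    have D: "Dom (Kl M) (p, X) = P" "Cod (Kl M) (p, X) = X" using p' by (auto simp: Kl_sel hom_def)
    fix c assume "c \<in> hom (Kl M) (Dom (Kl M) (p, X)) (BO M (Dom (Kl M) (p, X)))"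
    then have c: "c \<in> hom (Kl M) P (BO M P)" by (simp only: D)
    have pK: "(p, X) \<in> hom (Kl M) P X" using p(2) by (simp add: Kl_hom)
    let ?Bp = "lift (BO M) (BBar M) (p, X)" and ?S = "lift (SigO M) (SigBar M)"
      and ?B0p = "(B0Bar M X p, B0O M X)"
    let ?r = "\<lambda>X. (\<rho> X, BO M (StarO M X))" and ?I = "KlP.tuple (Id (Kl M) P) c"
    have [simp]: "c \<in> Arr (Kl M)" "Dom (Kl M) c = P" "Cod (Kl M) c = BO M P"
      "(p, X) \<in> Arr (Kl M)" "Dom (Kl M) (p, X) = P" "Cod (Kl M) (p, X) = X"
      using c pK by (auto simp: hom_def)
    have B0: "?B0p \<in> hom (Kl M) (Cop M P (BO M P)) (Cop M X (BO M X))"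
      using p' distributive_lawD(1-3)[OF dB]
      by (simp add: Kl_sel hom_def B0Bar_kcop_arr[OF p' X] BBar_def B0O_def)
    have t: "KlP.tuple (p, X) (?Bp \<odot>\<^bsub>Kl M\<^esub> c) = ?B0p \<odot>\<^bsub>Kl M\<^esub> ?I"
    proof -
      have "?Bp \<odot>\<^bsub>Kl M\<^esub> c \<in> hom (Kl M) P (BO M X)" by (simp add: hom_def)
      moreover have "Id (Kl M) P \<in> hom (Kl M) P P" by (simp add: hom_def)
      ultimately show ?thesis
        using Kl_tuple[OF pK] Kl_tuple[OF _ c] B0Bar_kpair[of p P X "fst c"] p(2) c
        by (simp add: Kl_sel Kl_hom lift_def B0O_def)
    qed
    have n: "?r X \<odot>\<^bsub>Kl M\<^esub> ?S ?B0p =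
        lift (BO M) (BBar M) (lift (StarO M) (StarBar M) (p, X)) \<odot>\<^bsub>Kl M\<^esub> ?r P"
      using natural_wrt_affine[OF assms(2) p(1) X] by (simp add: Kl_sel lift_def natural_wrt_def)
    note [simp] = B0[unfolded hom_def, simplified]
    have "?r X \<odot>\<^bsub>Kl M\<^esub> ?S (?B0p \<odot>\<^bsub>Kl M\<^esub> ?I) =
        lift (BO M) (BBar M) (lift (StarO M) (StarBar M) (p, X)) \<odot>\<^bsub>Kl M\<^esub> ?r P \<odot>\<^bsub>Kl M\<^esub> ?S ?I"
      by (simp add: KlSig.map_Comp Kl.Comp_reassoc[OF n])
    then show "?r (Cod (Kl M) (p, X)) \<odot>\<^bsub>Kl M\<^esub> ?S (KlP.tuple (p, X) (?Bp \<odot>\<^bsub>Kl M\<^esub> c)) =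
        lift (BO M) (BBar M) (lift (StarO M) (StarBar M) (p, X)) \<odot>\<^bsub>Kl M\<^esub>
        ?r (Dom (Kl M) (p, X)) \<odot>\<^bsub>Kl M\<^esub> ?S (KlP.tuple (Id (Kl M) (Dom (Kl M) (p, X))) c)"
      by (simp only: D t)
  qed
  have S [simp]: "muSig M \<in> Obj M" "iota M \<in> Arr M" "Dom M (iota M) = SigO M (muSig M)"
    "Cod M (iota M) = muSig M"
    using muSig by (auto simp: initial_algebra_def hom_def)
  have k: "iota_hat M \<in> hom M (StarO M (muSig M)) (muSig M)"
    "iota_hat M \<odot>\<^bsub>M\<^esub> star_op M (muSig M) = iota M \<odot>\<^bsub>M\<^esub> SigA M (iota_hat M)"
    "iota_hat M \<odot>\<^bsub>M\<^esub> star_unit M (muSig M) = Id M (muSig M)"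
    using theI'[OF F.free_ex1[of "iota M" "muSig M" "Id M (muSig M)" "muSig M"]]
    by (simp_all add: iota_hat_def star_ext_def hom_def)
  note [simp] = k(1)[unfolded hom_def, simplified]
  have g: "(\<gamma>, BO M (muSig M)) \<in> hom (Kl M) (muSig M) (BO M (muSig M))"
    using assms(3) by (simp add: operational_model_def Kl_hom)
  have t: "tr \<in> khom M (muSig M) (muB M)"
    using assms(4) by (simp add: trace_morphism_def)
  then have t': "tr \<in> hom M (muSig M) (TO M (muB M))" by (simp add: khom_def)
  have "\<exists>a \<in> hom (Kl M) (SigO M (muB M)) (muB M).
    (tr, muB M) \<odot>\<^bsub>Kl M\<^esub> JK M (iota M) = a \<odot>\<^bsub>Kl M\<^esub> lift (SigO M) (SigBar M) (tr, muB M)"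
  proof (rule G.trace_congruence[OF Kl_final_coalgebra, where k="JK M (iota_hat M)"])
    show "JK M (iota M) \<in> hom (Kl M) (SigO M (muSig M)) (muSig M)"
      "JK M (iota_hat M) \<in> hom (Kl M) (StarO M (muSig M)) (muSig M)"
      by (simp_all add: hom_def)
    show "JK M (iota_hat M) \<odot>\<^bsub>Kl M\<^esub> JK M (star_op M (muSig M)) =
      JK M (iota M) \<odot>\<^bsub>Kl M\<^esub> lift (SigO M) (SigBar M) (JK M (iota_hat M))"
      "JK M (iota_hat M) \<odot>\<^bsub>Kl M\<^esub> JK M (star_unit M (muSig M)) = Id (Kl M) (muSig M)"
      by (simp_all add: SigBar_JK JK_Comp k JK_Id)
    show "(\<gamma>, BO M (muSig M)) \<in> hom (Kl M) (muSig M) (BO M (muSig M))" by (rule g)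
    show "(\<gamma>, BO M (muSig M)) \<odot>\<^bsub>Kl M\<^esub> JK M (iota M) = lift (BO M) (BBar M) (JK M (iota_hat M)) \<odot>\<^bsub>Kl M\<^esub>
      (\<rho> (muSig M), BO M (StarO M (muSig M))) \<odot>\<^bsub>Kl M\<^esub>
      lift (SigO M) (SigBar M) (KlP.tuple (Id (Kl M) (muSig M)) (\<gamma>, BO M (muSig M)))"
      using assms(3) Kl_tuple[OF Kl.Id_hom g]
      by (simp add: operational_model_def Kl_sel lift_def JK_def B0O_def)
    show "(tr, muB M) \<in> hom (Kl M) (muSig M) (muB M)" using t by (simp add: Kl_hom)
    \<comment> \<open>\<open>lambek\<close> supplies the codomain of the inverse of
      \<open>beta\<close>, which is the tag that \<open>JK\<close> attaches to it.\<close>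
    show "lift (BO M) (BBar M) (tr, muB M) \<odot>\<^bsub>Kl M\<^esub> (\<gamma>, BO M (muSig M)) =
      JK M (inverse_arr M (beta M)) \<odot>\<^bsub>Kl M\<^esub> (tr, muB M)"
      using assms(4) B.lambek[OF muB]
      by (simp add: trace_morphism_def Kl_sel lift_def JK_def is_inverse_def hom_def)
    show "G.natural_at (JK M (iota_hat M))"
      unfolding JK_def by (rule nat[OF affine_J]) (use k(1) in \<open>simp_all add: khom_def hom_def J_def\<close>)
    have "G.natural_at (StarBar M (muB M) tr, StarO M (muB M))"
      by (rule nat[OF affine_StarBar[OF t' _ assms(5)]])
        (use t' distributive_lawD(1-3)[OF dStar] in \<open>simp_all add: khom_def hom_def StarBar_def\<close>)
    then show "G.natural_at (lift (StarO M) (StarBar M) (tr, muB M))"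
      by (simp add: lift_def[of _ _ "(tr, muB M)"])
  qed
  then obtain a where a: "a \<in> hom (Kl M) (SigO M (muB M)) (muB M)"
    "(tr, muB M) \<odot>\<^bsub>Kl M\<^esub> JK M (iota M) = a \<odot>\<^bsub>Kl M\<^esub> lift (SigO M) (SigBar M) (tr, muB M)" by blast
  have [simp]: "fst a \<in> Arr M" "Dom M (fst a) = SigO M (muB M)" "Cod M (fst a) = TO M (muB M)" "snd a = muB M"
    using a(1) by (auto simp: Kl_sel hom_def)
  note [simp] = t'[unfolded hom_def, simplified] distributive_lawD(1-3)[OF dSig]
  \<comment> \<open>A Kleisli algebra on \<open>muB\<close> becomes a base algebra on
    \<open>TO M (muB M)\<close> by extending it along \<open>mu\<close> and precomposing with the
    distributive law. Unfolding \<open>SigBar\<close> in the Kleisli equation then leaves exactly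
    \<open>?a\<close> after \<open>SigA M tr\<close>.\<close>
  let ?a = "mu M (muB M) \<odot>\<^bsub>M\<^esub> TA M (fst a) \<odot>\<^bsub>M\<^esub> dSig M (muB M)"
  have "tr \<odot>\<^bsub>M\<^esub> iota M = ?a \<odot>\<^bsub>M\<^esub> SigA M tr"
    using a(2) by (subst (asm) Comp_JK) (simp_all add: Kl_sel lift_def kcomp_def SigBar_def)
  moreover have "?a \<in> hom M (SigO M (TO M (muB M))) (TO M (muB M))" by (simp add: hom_def)
  ultimately show ?thesis unfolding morphic_congruence_def by blast
qed

end
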